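(* Let $0<\nu\le1$ and let $(\lambda_k)_{k\ge1}$ be pairwise distinct positive reals. Let $\mathcal N_\nu(t)$, $t>0$, be the fractional birth process with rates $\lambda_k$ and one initial progenitor, let $\mathcal N(t)=\mathcal N_1(t)$ be the classical birth process with the same rates and one initial progenitor, and let $T_{2\nu}(t)$, $t>0$, be the random time defined in the context, independent of $\mathcal N$. Then $\mathcal N_\nu(t)=\mathcal N(T_{2\nu}(t))$ for $t>0$ in the sense of one-dimensional distributions, that is, for all $t>0$ and $k\ge1$, $$\Pr\{\mathcal N_\nu(t)=k\}=\int_0^\infty \Pr\{\mathcal N(s)=k\}\,\Pr\{T_{2\nu}(t)\in \mathrm{d}s\}.$$
   Context: The state probabilities $p_k^\nu(t)=\Pr\{\mathcal N_\nu(t)=k\}$, $k\ge1$, of the fractional birth process are the solution of $$\frac{\mathrm{d}^\nu p_k}{\mathrm{d}t^\nu}=-\lambda_kp_k+\lambda_{k-1}p_{k-1},\quad k\ge1,\qquad p_1(0)=1,\quad p_k(0)=0\ (k\ge2),$$ with $\lambda_0p_0\equiv0$, where for $0<\nu<1$, $\frac{\mathrm{d}^\nu p}{\mathrm{d}t^\nu}(t)=\frac{1}{\Gamma(1-\nu)}\int_0^t\frac{p'(s)}{(t-s)^\nu}\mathrm{d}s$ (Dzherbashyan--Caputo derivative) and for $\nu=1$ it is the ordinary derivative. Explicitly, $p_1^\nu(t)=E_{\nu,1}(-\lambda_1t^\nu)$ and, for $k>1$, $p_k^\nu(t)=\prod_{j=1}^{k-1}\lambda_j\sum_{m=1}^k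 \frac{E_{\nu,1}(-\lambda_mt^\nu)}{\prod_{l=1,l\ne m}^k(\lambda_l-\lambda_m)}$, with $E_{\nu,1}(x)=\sum_{h\ge0}\frac{x^h}{\Gamma(\nu h+1)}$. For $\nu=1$ this is the classical law of $\mathcal N$, with $E_{1,1}(-\lambda_m t)=e^{-\lambda_mt}$. The random time $T_{2\nu}(t)$ is nonnegative with law $\Pr\{T_{2\nu}(t)\in\mathrm{d}s\}=2u_{2\nu}(s,t)\,\mathrm{d}s$ for $s>0$ (and $0$ for $s<0$), where $u_{2\nu}$ is the fundamental solution of the fractional diffusion equation $\frac{\partial^{2\nu}u}{\partial t^{2\nu}}=\frac{\partial^2u}{\partial s^2}$ (time derivative in the Dzherbashyan--Caputo sense) with $u(s,0)=\delta(s)$ and, for $1/2<\nu\le1$, also $u_t(s,0)=0$. Equivalently, its density $f_{T_{2\nu}}(s,t)$ satisfies $\int_0^\infty e^{-\mu t}f_{T_{2\nu}}(s,t)\,\mathrm{d}t=\mu^{\nu-1}e^{-s\mu^\nu}$ for $s>0$, $\mu>0$; for $\nu=1$, $T_2(t)=t$ almost surely. *)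

theory Defs
  imports "HOL-Probability.Probability" "HOL-Library.Extended_Nat"
begin

section \<open>Dzherbashyan--Caputo derivatives on the half-line\<close>

text \<open>
  The derivative of order \<open>\<alpha> > 0\<close> of a function on \<open>[0, \<infinity>)\<close>, at a point \<open>t > 0\<close>.
  With \<open>n = \<lceil>\<alpha>\<rceil>\<close> it is the ordinary \<open>n\<close>-th derivative if \<open>\<alpha> = n\<close>, and
  \<open>1 / \<Gamma>(n - \<alpha>) \<integral>\<^sub>0\<^sup>t f\<^sup>(\<^sup>n\<^sup>)(s) (t - s)\<^sup>n\<^sup>-\<^sup>\<alpha>\<^sup>-\<^sup>1 ds\<close> otherwise.
  Only the values of \<open>f\<close> on \<open>(0, \<infinity>)\<close> matter.
\<close>

definition caputo :: "real \<Rightarrow> (real \<Rightarrow> real) \<Rightarrow> real \<Rightarrow> real" where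
  "caputo \<alpha> f t =
    (let n = nat \<lceil>\<alpha>\<rceil> in
     if \<alpha> = real n then (deriv ^^ n) f t
     else 1 / Gamma (real n - \<alpha>) *
            (LINT s:{0<..<t}|lborel. (deriv ^^ n) f s / (t - s) powr (\<alpha> - real n + 1)))"

text \<open>
  The Isabelle integral of a non-integrable function is \<open>0\<close> and \<open>deriv\<close> is a total function, so
  an equation for \<^const>\<open>caputo\<close> is meaningful only together with the following regularity. The
  integrability of the \<open>n\<close>-th derivative near \<open>0\<close> makes \<open>f\<close> and its derivatives of order less
  than \<open>n\<close> absolutely continuous up to the origin.
\<close>

definition caputo_differentiable :: "real \<Rightarrow> (real \<Rightarrow> real) \<Rightarrow> bool" where
  "caputo_differentiable \<alpha> f \<longleftrightarrow>
    (let n = nat \<lceil>\<alpha>\<rceil> in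
     continuous_on {0..} f \<and>
     (\<forall>i<n. \<forall>t>0. (deriv ^^ i) f field_differentiable (at t)) \<and>
     (\<forall>t>0. set_integrable lborel {0<..<t} ((deriv ^^ n) f)) \<and>
     (\<alpha> \<noteq> real n \<longrightarrow>
       (\<forall>t>0. set_integrable lborel {0<..<t}
                 (\<lambda>s. (deriv ^^ n) f s / (t - s) powr (\<alpha> - real n + 1)))))"


section \<open>The fractional birth process\<close>

definition solves_birth_system ::
  "real \<Rightarrow> (nat \<Rightarrow> real) \<Rightarrow> (nat \<Rightarrow> real \<Rightarrow> real) \<Rightarrow> bool" where
  "solves_birth_system \<nu> r p \<longleftrightarrow>
    (\<forall>k\<ge>1.
       caputo_differentiable \<nu> (p k) \<and>
       (\<forall>t>0. caputo \<nu> (p k) t =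
          - r k * p k t + (if k = 1 then 0 else r (k - 1) * p (k - 1) t)) \<and>
       p k 0 = (if k = 1 then 1 else 0))"

text \<open>
  Processes take values in \<^typ>\<open>enat\<close>: the rates are arbitrary, and if
  \<open>\<Sum>k. 1 / r k\<close> converges then the state probabilities sum to less than \<open>1\<close>,
  the missing mass being that of the exploded state \<open>\<infinity>\<close>.
\<close>

definition state_prob :: "'a measure \<Rightarrow> (real \<Rightarrow> 'a \<Rightarrow> enat) \<Rightarrow> nat \<Rightarrow> real \<Rightarrow> real" where
  "state_prob M X k t = measure M {\<omega> \<in> space M. X t \<omega> = enat k}"

text \<open>
  As a fractional birth process is specified only through its state probabilities, no joint law
  at several times is prescribed.
\<close>

definition fractional_birth_process ::
  "'a measure \<Rightarrow> real \<Rightarrow> (nat \<Rightarrow> real) \<Rightarrow> (real \<Rightarrow> 'a \<Rightarrow> enat) \<Rightarrow> bool" where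
  "fractional_birth_process M \<nu> r X \<longleftrightarrow>
    prob_space M \<and>
    (\<forall>t\<ge>0. X t \<in> measurable M (count_space UNIV)) \<and>
    (\<forall>t\<ge>0. \<forall>\<omega>\<in>space M. X t \<omega> \<ge> 1) \<and>
    solves_birth_system \<nu> r (state_prob M X)"

abbreviation classical_birth_process ::
  "'a measure \<Rightarrow> (nat \<Rightarrow> real) \<Rightarrow> (real \<Rightarrow> 'a \<Rightarrow> enat) \<Rightarrow> bool" where
  "classical_birth_process M r X \<equiv> fractional_birth_process M 1 r X"

definition right_continuous_paths :: "'a measure \<Rightarrow> (real \<Rightarrow> 'a \<Rightarrow> enat) \<Rightarrow> bool" where
  "right_continuous_paths M X \<longleftrightarrow>
    (\<forall>\<omega>\<in>space M. \<forall>s\<ge>0. ((\<lambda>q. X q \<omega>) \<longlongrightarrow> X s \<omega>) (at_right s))"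


section \<open>The fundamental solution of the fractional diffusion equation\<close>

definition test_function :: "(real \<Rightarrow> real) \<Rightarrow> bool" where
  "test_function \<phi> \<longleftrightarrow>
    (\<forall>n x. (deriv ^^ n) \<phi> field_differentiable (at x)) \<and>
    (\<exists>R. \<forall>x. \<bar>x\<bar> > R \<longrightarrow> \<phi> x = 0)"

text \<open>
  The equation \<open>\<partial>\<^sub>t\<^sup>\<alpha> u = \<partial>\<^sub>s\<^sub>s u\<close> on \<open>\<real> \<times> (0, \<infinity>)\<close> with \<open>u(s, 0) = \<delta>(s)\<close>
  and, if \<open>\<alpha> > 1\<close>, \<open>u\<^sub>t(s, 0) = 0\<close>, for \<open>0 < \<alpha> \<le> 2\<close>. It is understood in the sense of
  distributions in \<open>s\<close>, with \<open>U t\<close> in the role of \<open>u(s, t) ds\<close>. A pointwise reading is not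
  possible: for \<open>\<alpha> \<noteq> 1\<close>, \<open>\<alpha> < 2\<close>, the solution has a kink at \<open>s = 0\<close>, and for \<open>\<alpha> = 2\<close>
  (wave equation) it is the measure \<open>(\<delta>\<^sub>t + \<delta>\<^sub>-\<^sub>t) / 2\<close>, which has no density.
\<close>

definition fundamental_solution :: "real \<Rightarrow> (real \<Rightarrow> real measure) \<Rightarrow> bool" where
  "fundamental_solution \<alpha> U \<longleftrightarrow>
    (\<forall>t\<ge>0. prob_space (U t) \<and> sets (U t) = sets borel) \<and>
    U 0 = return borel 0 \<and>
    (\<forall>\<phi>. test_function \<phi> \<longrightarrow>
       (let h = (\<lambda>t. LINT s|U t. \<phi> s) in
        caputo_differentiable \<alpha> h \<and>
        (\<forall>t>0. caputo \<alpha> h t = (LINT s|U t. (deriv ^^ 2) \<phi> s)) \<and>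
        (\<alpha> > 1 \<longrightarrow> (h has_real_derivative 0) (at 0 within {0..}))))"

text \<open>
  The random times \<open>T\<^sub>2\<^sub>\<nu>(t)\<close>, \<open>t > 0\<close>: nonnegative, with law \<open>2 u\<^sub>2\<^sub>\<nu>(s, t) ds\<close> on \<open>s > 0\<close>.
\<close>

definition diffusion_random_time ::
  "'a measure \<Rightarrow> real \<Rightarrow> (real \<Rightarrow> 'a \<Rightarrow> real) \<Rightarrow> bool" where
  "diffusion_random_time M \<nu> T \<longleftrightarrow>
    (\<exists>U. fundamental_solution (2 * \<nu>) U \<and>
      (\<forall>t>0. T t \<in> borel_measurable M \<and>
             (\<forall>\<omega>\<in>space M. T t \<omega> \<ge> 0) \<and>
             distr M borel (T t) = density (U t) (\<lambda>s. 2 * indicator {0<..} s)))"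

text \<open>
  Independence of a random time \<open>\<tau>\<close> and a whole process \<open>(X\<^sub>s)\<^sub>s\<^sub>\<ge>\<^sub>0\<close>, as independence of the
  generated \<open>\<sigma>\<close>-algebras. (The library's \<open>indep_var\<close> needs both variables to have the same type.)
\<close>

definition indep_of_process ::
  "'a measure \<Rightarrow> ('a \<Rightarrow> real) \<Rightarrow> (real \<Rightarrow> 'a \<Rightarrow> enat) \<Rightarrow> bool" where
  "indep_of_process M \<tau> X \<longleftrightarrow>
    prob_space.indep_set M
      (sets (vimage_algebra (space M) \<tau> borel))
      (sets (vimage_algebra (space M) (\<lambda>\<omega>. \<lambda>s\<in>{0..}. X s \<omega>)
               (PiM {0..} (\<lambda>_. count_space UNIV))))"

end

theory Submission
  imports Defs "HOL-Computational_Algebra.Polynomial"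
begin

text \<open>
  Let \<open>p\<^sub>k\<close> and \<open>q\<^sub>k\<close> be the state probabilities of the fractional and of the classical process.
  Everything is compared through Laplace transforms in the time variable, under which a Caputo
  derivative of order \<open>\<alpha>\<close> becomes multiplication by \<open>\<mu>\<^sup>\<alpha>\<close> (\<open>caputo_laplace\<close>). Fix \<open>\<mu> > 0\<close>
  and put \<open>c = \<mu>\<^sup>\<nu>\<close>.

  The transforms of the \<open>p\<^sub>k\<close> at \<open>\<mu>\<close> and those of the \<open>q\<^sub>k\<close> at \<open>c\<close> satisfy the same first-order
  recursion in \<open>k\<close>, up to a factor \<open>c / \<mu>\<close> in its initial term. So the transform of \<open>p\<^sub>k\<close> at
  \<open>\<mu>\<close> is \<open>c / \<mu>\<close> times that of \<open>q\<^sub>k\<close> at \<open>c\<close> (\<open>birth_system_laplace_subordination\<close>).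

  For the random time, let \<open>W\<close> be the law of the diffusion kernel \<open>U\<close> at an independent exponential
  time of rate \<open>\<mu>\<close>. The fractional diffusion equation says that \<open>W - c\<^sup>-\<^sup>2 W'' = \<delta>\<close> in the sense
  of distributions, and the only probability measure with this property is the two-sided exponential
  law of rate \<open>c\<close>. Its positive half is the exponential law of rate \<open>c\<close>: looked at after an
  exponential time of rate \<open>\<mu>\<close>, the random time is exponential of rate \<open>c\<close>. Hence the mean of
  \<open>q\<^sub>k\<close> over the random time also has the transform \<open>c / \<mu>\<close> times that of \<open>q\<^sub>k\<close> at \<open>c\<close>
  (\<open>fundamental_solution_laplace\<close>). Both functions of \<open>t\<close> are bounded and continuous, and the
  Laplace transform is injective on such functions (\<open>laplace_eq_0_imp_eq_0\<close>).

  The continuity in \<open>t\<close> of the mean of \<open>q\<^sub>k\<close> is a statement about weak convergence, whereas the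
  diffusion equation is known only on smooth functions with compact support. It is obtained from
  the conservation of mass, by cutoffs with wide bump functions, and from the continuity theorem for
  characteristic functions (\<open>fundamental_solution_weakly_continuous\<close>).

  For the equality of laws with right-continuous paths, the random time is approximated from the right
  by times with countably many values, at which independence can be applied value by value
  (\<open>prob_at_random_time\<close>).
\<close>

section \<open>Laplace transforms and Riemann--Liouville integrals\<close>

definition laplace :: "real \<Rightarrow> (real \<Rightarrow> real) \<Rightarrow> real" where
  "laplace \<mu> f = (LINT t:{0<..}|lborel. exp (- \<mu> * t) * f t)"

definition rl_kernel :: "real \<Rightarrow> real \<Rightarrow> real" where
  "rl_kernel a x = indicator {0<..} x * x powr (a - 1) / Gamma a"

definition rl_integral :: "real \<Rightarrow> (real \<Rightarrow> real) \<Rightarrow> real \<Rightarrow> real" where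
  "rl_integral a g t = (LINT s:{0<..<t}|lborel. rl_kernel a (t - s) * g s)"

lemma Gamma_real_nonzero: "Gamma a \<noteq> 0" if "0 < a" for a :: real
  using Gamma_real_pos[OF that] by (metis less_irrefl)

lemma rl_kernel_measurable [measurable]: "rl_kernel a \<in> borel_measurable borel"
  unfolding rl_kernel_def[abs_def] by measurable

lemma convolution_integral:
  fixes f g :: "real \<Rightarrow> real"
  assumes f: "integrable lborel f" and g: "integrable lborel g"
  shows "integrable lborel (\<lambda>x. \<integral>y. f (x - y) * g y \<partial>lborel)"
    and "(\<integral>x. (\<integral>y. f (x - y) * g y \<partial>lborel) \<partial>lborel) = integral\<^sup>L lborel f * integral\<^sup>L lborel g"
proof -
  have [measurable]: "f \<in> borel_measurable borel" "g \<in> borel_measurable borel"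
    using f g by (auto dest: borel_measurable_integrable)
  have shift: "integrable lborel (\<lambda>x. h (x - y))" "(\<integral>x. h (x - y) \<partial>lborel) = integral\<^sup>L lborel h"
    if "integrable lborel h" for h :: "real \<Rightarrow> real" and y
    using lborel_integrable_real_affine[OF that, of 1 "- y"]
      lborel_integral_real_affine[of 1 h "- y"] by simp_all
  have nf: "integrable lborel (\<lambda>x. norm (f x))"
    using f by simp
  have 1: "integrable (lborel \<Otimes>\<^sub>M lborel) (\<lambda>(y, x). f (x - y) * g y)"
  proof (rule lborel_pair.Fubini_integrable)
    have "(\<lambda>y. \<integral>x. norm (f (x - y)) * norm (g y) \<partial>lborel)
        = (\<lambda>y. (\<integral>x. norm (f x) \<partial>lborel) * norm (g y))"
      by (simp add: shift(2)[OF nf, simplified])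
    then show "integrable lborel (\<lambda>y. \<integral>x. norm (case (y, x) of (y, x) \<Rightarrow> f (x - y) * g y) \<partial>lborel)"
      using g by (simp add: abs_mult)
    show "AE y in lborel. integrable lborel (\<lambda>x. case (y, x) of (y, x) \<Rightarrow> f (x - y) * g y)"
      using shift(1)[OF f] by simp
  qed simp
  from lborel_pair.integrable_snd[OF 1] lborel_pair.Fubini_integral[OF 1]
  show "integrable lborel (\<lambda>x. \<integral>y. f (x - y) * g y \<partial>lborel)"
    "(\<integral>x. (\<integral>y. f (x - y) * g y \<partial>lborel) \<partial>lborel) = integral\<^sup>L lborel f * integral\<^sup>L lborel g"
    by (simp_all add: shift(2)[OF f])
qed

lemma laplace_rl_kernel:
  assumes "0 < a" "0 < \<mu>"
  shows "has_bochner_integral lborel (\<lambda>x. exp (- \<mu> * x) * rl_kernel a x) (\<mu> powr (- a))"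
proof -
  have "has_bochner_integral lborel (\<lambda>t. indicator {0..} t * t powr (a - 1) / exp t) (Gamma a)"
    using assms by (intro has_bochner_integral_nn_integral)
      (auto simp: Gamma_conv_nn_integral_real Gamma_real_pos less_imp_le)
  then have "has_bochner_integral lborel
      (\<lambda>x. indicator {0..} (\<mu> * x) * (\<mu> * x) powr (a - 1) / exp (\<mu> * x)) (Gamma a / \<mu>)"
    using lborel_has_bochner_integral_real_affine_iff[of \<mu>
        "\<lambda>t. indicator {0..} t * t powr (a - 1) / exp t" "Gamma a" 0] assms
    by (simp add: field_simps)
  from has_bochner_integral_mult_right[OF this, of "\<mu> powr (1 - a) / Gamma a"]
  have *: "has_bochner_integral lborel (\<lambda>x. \<mu> powr (1 - a) / Gamma a *
      (indicator {0..} (\<mu> * x) * (\<mu> * x) powr (a - 1) / exp (\<mu> * x)))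
      (\<mu> powr (1 - a) / Gamma a * (Gamma a / \<mu>))"
    by simp
  have eq1: "\<mu> powr (1 - a) / Gamma a * (Gamma a / \<mu>) = \<mu> powr (- a)"
    using assms Gamma_real_nonzero[of a] by (simp add: powr_diff powr_minus field_simps)
  have "\<mu> powr (1 - a) * \<mu> powr (a - 1) = 1"
    using assms by (simp flip: powr_add)
  then have eq2: "\<mu> powr (1 - a) / Gamma a *
      (indicator {0..} (\<mu> * x) * (\<mu> * x) powr (a - 1) / exp (\<mu> * x)) = exp (- \<mu> * x) * rl_kernel a x" for x
    using assms
    by (cases "x > 0"; cases "x = 0")
       (auto simp: rl_kernel_def indicator_def powr_mult exp_minus field_simps zero_le_mult_iff)
  show ?thesis
    using * unfolding eq1 eq2 .
qed

text \<open>
  The exponential weight is a character of \<open>(\<real>, +)\<close>, so it distributes over the convolution with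
  the kernel and the integral of a convolution is the product of the integrals.
\<close>

lemma laplace_rl_integral:
  assumes "0 < a" "0 < \<mu>"
    and g: "set_integrable lborel {0<..} (\<lambda>t. exp (- \<mu> * t) * g t)"
  shows "set_integrable lborel {0<..} (\<lambda>t. exp (- \<mu> * t) * rl_integral a g t)"
    and "laplace \<mu> (rl_integral a g) = \<mu> powr (- a) * laplace \<mu> g"
proof -
  define F where "F x = exp (- \<mu> * x) * rl_kernel a x" for x
  define G where "G x = indicator {0<..} x * (exp (- \<mu> * x) * g x)" for x
  have F: "integrable lborel F" "integral\<^sup>L lborel F = \<mu> powr (- a)"
    using laplace_rl_kernel[OF assms(1,2)] unfolding F_def[abs_def] has_bochner_integral_iff by auto
  have G: "integrable lborel G" "integral\<^sup>L lborel G = laplace \<mu> g"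
    using g unfolding G_def[abs_def] laplace_def set_integrable_def set_lebesgue_integral_def by auto
  have eq: "(\<integral>y. F (x - y) * G y \<partial>lborel) = indicator {0<..} x * (exp (- \<mu> * x) * rl_integral a g x)" for x
  proof -
    have "F (x - y) * G y = indicator {0<..} x * (exp (- \<mu> * x) *
        (indicator {0<..<x} y * (rl_kernel a (x - y) * g y)))" for y
    proof -
      have "exp (- \<mu> * (x - y)) * exp (- \<mu> * y) = exp (- \<mu> * x)"
        by (simp flip: exp_add add: algebra_simps)
      then show ?thesis
        unfolding F_def G_def rl_kernel_def by (auto simp: indicator_def)
    qed
    then show ?thesis
      by (simp add: rl_integral_def set_lebesgue_integral_def)
  qed
  show "set_integrable lborel {0<..} (\<lambda>t. exp (- \<mu> * t) * rl_integral a g t)"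
    using convolution_integral(1)[OF F(1) G(1)] by (simp add: eq set_integrable_def)
  show "laplace \<mu> (rl_integral a g) = \<mu> powr (- a) * laplace \<mu> g"
    using convolution_integral(2)[OF F(1) G(1)]
    by (simp add: eq F(2) G(2)) (simp add: laplace_def set_lebesgue_integral_def)
qed

text \<open>The semigroup relation \<open>I\<^sup>b I\<^sup>1\<^sup>-\<^sup>b = I\<^sup>1\<close> comes down to this instance of Euler's Beta integral.\<close>

lemma rl_kernel_convolution:
  assumes "0 < b" "b < 1" "u < t"
  shows "has_bochner_integral lborel (\<lambda>s. rl_kernel b (t - s) * rl_kernel (1 - b) (s - u)) 1"
proof -
  have "has_bochner_integral lborel
      (\<lambda>x. indicator {0..1} x * (x powr ((1 - b) - 1) * (1 - x) powr (b - 1))) (Beta (1 - b) b)"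
  proof (rule has_bochner_integral_nn_integral)
    show "(\<integral>\<^sup>+x. ennreal (indicator {0..1} x * (x powr ((1 - b) - 1) * (1 - x) powr (b - 1))) \<partial>lborel) =
        ennreal (Beta (1 - b) b)"
      using nn_integral_has_integral_lebesgue[OF _ has_integral_Beta_real[of "1 - b" b]] assms
      by simp
    show "0 \<le> Beta (1 - b) b"
      using assms by (simp add: Beta_def Gamma_real_pos less_imp_le)
  qed auto
  moreover have "Beta (1 - b) b = Gamma (1 - b) * Gamma b"
    by (simp add: Beta_def)
  ultimately have B: "has_bochner_integral lborel
      (\<lambda>x. indicator {0..1} x * (x powr (- b) * (1 - x) powr (b - 1))) (Gamma (1 - b) * Gamma b)"
    by simp
  define c where "c = t - u"
  have c: "0 < c" using assms by (simp add: c_def)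
  from lborel_has_bochner_integral_real_affine_iff[of "1 / c"
      "\<lambda>x. indicator {0..1} x * (x powr (- b) * (1 - x) powr (b - 1))" "Gamma (1 - b) * Gamma b" "- u / c"]
  have "has_bochner_integral lborel (\<lambda>s. indicator {0..1} ((s - u) / c) *
      (((s - u) / c) powr (- b) * (1 - (s - u) / c) powr (b - 1))) (c * (Gamma (1 - b) * Gamma b))"
    using c B by (simp add: diff_divide_distrib)
  from has_bochner_integral_mult_right[OF this, of "1 / (c * (Gamma (1 - b) * Gamma b))"]
  have *: "has_bochner_integral lborel (\<lambda>s. 1 / (c * (Gamma (1 - b) * Gamma b)) * (indicator {0..1} ((s - u) / c) *
      (((s - u) / c) powr (- b) * (1 - (s - u) / c) powr (b - 1)))) 1"
    using c assms Gamma_real_nonzero[of b] Gamma_real_nonzero[of "1 - b"] by simp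
  have eq: "1 / (c * (Gamma (1 - b) * Gamma b)) * (indicator {0..1} ((s - u) / c) *
      (((s - u) / c) powr (- b) * (1 - (s - u) / c) powr (b - 1)))
      = rl_kernel b (t - s) * rl_kernel (1 - b) (s - u)" for s
  proof (cases "u < s \<and> s < t")
    case True
    have 1: "1 - (s - u) / c = (t - s) / c"
      using c by (simp add: c_def field_simps)
    have 2: "c powr (- b) * c powr (b - 1) = 1 / c"
      using c powr_minus_divide[of c 1] by (simp flip: powr_add)
    have "indicator {0..1} ((s - u) / c) = (1::real)"
      using True c by (simp add: c_def indicator_def)
    then show ?thesis
      using True c 2 unfolding 1 rl_kernel_def
      by (simp add: powr_divide) (simp add: field_simps)
  next
    case False
    then show ?thesis
      using c by (cases "s = u"; cases "s = t") (auto simp: rl_kernel_def indicator_def c_def field_simps)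
  qed
  show ?thesis
    using * unfolding eq .
qed

lemma rl_integral_one: "rl_integral 1 g t = (LINT s:{0<..<t}|lborel. g s)"
  unfolding rl_integral_def
  by (intro set_lebesgue_integral_cong) (auto simp: rl_kernel_def)

lemma rl_integral_semigroup:
  assumes b: "0 < b" "b < 1"
    and d: "set_integrable lborel {0<..<t} d"
  shows "rl_integral b (rl_integral (1 - b) d) t = (LINT u:{0<..<t}|lborel. d u)"
proof -
  define D where "D u = indicator {0<..<t} u * d u" for u
  have D: "integrable lborel D"
    using d unfolding D_def set_integrable_def by simp
  then have [measurable]: "D \<in> borel_measurable borel"
    by (auto dest: borel_measurable_integrable)
  define K where "K s u = rl_kernel b (t - s) * rl_kernel (1 - b) (s - u)" for s u
  have K: "integrable lborel (\<lambda>s. K s u)" "(\<integral>s. K s u \<partial>lborel) = 1" if "u < t" for u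
    using rl_kernel_convolution[OF b that] by (auto simp: K_def has_bochner_integral_iff)
  have K0: "0 \<le> K s u" for s u
    using b Gamma_real_pos[of b] Gamma_real_pos[of "1 - b"] by (simp add: K_def rl_kernel_def)
  have Kint: "(\<integral>s. K s u * D u \<partial>lborel) = D u" "(\<integral>s. K s u * \<bar>D u\<bar> \<partial>lborel) = \<bar>D u\<bar>" 
    "integrable lborel (\<lambda>s. K s u * D u)" for u
    using K[of u] by (cases "u < t"; simp add: D_def)+
  have 1: "integrable (lborel \<Otimes>\<^sub>M lborel) (\<lambda>(u, s). K s u * D u)"
  proof (rule lborel_pair.Fubini_integrable)
    show "integrable lborel (\<lambda>u. \<integral>s. norm (case (u, s) of (u, s) \<Rightarrow> K s u * D u) \<partial>lborel)"
      using D by (simp only: prod.case real_norm_def abs_mult abs_of_nonneg[OF K0] Kint(2) integrable_abs)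
  qed (use Kint in \<open>auto simp: K_def\<close>)
  have "(\<integral>u. K s u * D u \<partial>lborel) = indicator {0<..<t} s * (rl_kernel b (t - s) * rl_integral (1 - b) d s)" for s
  proof -
    have "K s u * D u = indicator {0<..<t} s * (rl_kernel b (t - s) *
        (indicator {0<..<s} u * (rl_kernel (1 - b) (s - u) * d u)))" for u
      unfolding K_def D_def rl_kernel_def by (auto simp: indicator_def)
    then show ?thesis
      by (simp add: rl_integral_def set_lebesgue_integral_def)
  qed
  then have "rl_integral b (rl_integral (1 - b) d) t = (\<integral>s. (\<integral>u. K s u * D u \<partial>lborel) \<partial>lborel)"
    by (simp add: rl_integral_def[of b] set_lebesgue_integral_def)
  also have "\<dots> = integral\<^sup>L lborel D"
    using lborel_pair.Fubini_integral[OF 1] by (simp only: Kint(1))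
  finally show ?thesis
    by (simp add: set_lebesgue_integral_def D_def[abs_def])
qed

lemma rl_integral_cong:
  assumes "\<And>s. 0 < s \<Longrightarrow> s < t \<Longrightarrow> g s = h s"
  shows "rl_integral a g t = rl_integral a h t"
  unfolding rl_integral_def using assms by (intro set_lebesgue_integral_cong) auto

lemma laplace_cong:
  assumes "\<And>t. 0 < t \<Longrightarrow> f t = g t"
  shows "laplace \<mu> f = laplace \<mu> g"
  unfolding laplace_def using assms by (intro set_lebesgue_integral_cong) auto

lemma laplace_const:
  assumes "0 < \<mu>"
  shows "set_integrable lborel {0<..} (\<lambda>t. exp (- \<mu> * t) * c)" and "laplace \<mu> (\<lambda>_. c) = c / \<mu>"
proof -
  have "has_bochner_integral lborel (\<lambda>t. indicator {0<..} t * exp (- \<mu> * t)) (\<mu> powr - 1)"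
  proof -
    have "exp (- \<mu> * t) * rl_kernel 1 t = indicator {0<..} t * exp (- \<mu> * t)" for t
      by (simp add: rl_kernel_def indicator_def)
    then show ?thesis
      using laplace_rl_kernel[of 1 \<mu>] assms by (simp add: mult.commute)
  qed
  from has_bochner_integral_mult_left[OF this, of c]
  have "has_bochner_integral lborel (\<lambda>t. indicator {0<..} t * exp (- \<mu> * t) * c) (c / \<mu>)"
    using assms by (simp add: powr_minus_divide)
  then show "set_integrable lborel {0<..} (\<lambda>t. exp (- \<mu> * t) * c)" "laplace \<mu> (\<lambda>_. c) = c / \<mu>"
    by (auto simp: has_bochner_integral_iff laplace_def set_lebesgue_integral_def set_integrable_def mult_ac)
qed

lemma laplace_integrable_bounded:
  fixes \<mu> C :: real
  assumes "0 < \<mu>" and "set_borel_measurable borel {0<..} g" and bnd: "\<And>t. 0 < t \<Longrightarrow> \<bar>g t\<bar> \<le> C"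
  shows "set_integrable lborel {0<..} (\<lambda>t. exp (- \<mu> * t) * g t)"
  unfolding set_integrable_def
proof (rule Bochner_Integration.integrable_bound)
  show "integrable lborel (\<lambda>t. indicator {0<..} t *\<^sub>R (exp (- \<mu> * t) * C))"
    using laplace_const(1)[OF assms(1), of C] by (simp add: set_integrable_def)
  have "(\<lambda>t. exp (- \<mu> * t) * (indicator {0<..} t *\<^sub>R g t)) \<in> borel_measurable borel"
    using assms(2) unfolding set_borel_measurable_def by measurable
  then show "(\<lambda>t. indicator {0<..} t *\<^sub>R (exp (- \<mu> * t) * g t)) \<in> borel_measurable lborel"
    by (simp add: mult_ac)
  have "\<bar>g t\<bar> \<le> \<bar>C\<bar>" if "0 < t" for t
    using bnd[OF that] by linarith
  then show "AE t in lborel. norm (indicator {0<..} t *\<^sub>R (exp (- \<mu> * t) * g t)) \<le>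
      norm (indicator {0<..} t *\<^sub>R (exp (- \<mu> * t) * C))"
    by (intro AE_I2) (simp add: abs_mult indicator_def)
qed

lemma laplace_add:
  assumes "set_integrable lborel {0<..} (\<lambda>t. exp (- \<mu> * t) * f t)"
    and "set_integrable lborel {0<..} (\<lambda>t. exp (- \<mu> * t) * g t)"
  shows "laplace \<mu> (\<lambda>t. f t + g t) = laplace \<mu> f + laplace \<mu> g"
  using set_integral_add(2)[OF assms] by (simp add: laplace_def algebra_simps)

lemma laplace_cmult: "laplace \<mu> (\<lambda>t. c * f t) = c * laplace \<mu> f"
proof -
  have "laplace \<mu> (\<lambda>t. c * f t) = (LINT t:{0<..}|lborel. c * (exp (- \<mu> * t) * f t))"
    by (simp add: laplace_def mult_ac)
  then show ?thesis
    by (simp add: laplace_def)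
qed

section \<open>From Caputo equations to Laplace transforms\<close>

lemma ftc_integrable:
  assumes "0 < t" and "continuous_on {0..} f"
    and "\<And>s. 0 < s \<Longrightarrow> (f has_real_derivative f' s) (at s)"
    and "set_integrable lborel {0<..<t} f'"
  shows "(LINT s:{0<..<t}|lborel. f' s) = f t - f 0"
proof -
  have "(f' has_integral (f t - f 0)) {0..t}"
    using assms by (intro fundamental_theorem_of_calculus_interior)
      (auto intro: continuous_on_subset simp flip: has_real_derivative_iff_has_vector_derivative)
  then have "(f' has_integral (f t - f 0)) {0<..<t}"
    by (simp add: has_integral_Icc_iff_Ioo)
  then show ?thesis
    using set_borel_integral_eq_integral(2)[OF assms(4)] by (simp add: integral_unique)
qed

lemma caputo_eq_rl_integral:
  assumes "n = nat \<lceil>\<alpha>\<rceil>" "\<alpha> \<noteq> real n"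
  shows "caputo \<alpha> f t = rl_integral (real n - \<alpha>) ((deriv ^^ n) f) t"
proof -
  have "rl_integral (real n - \<alpha>) ((deriv ^^ n) f) t = 
     (LINT s:{0<..<t}|lborel. 1 / Gamma (real n - \<alpha>) * ((deriv ^^ n) f s / (t - s) powr (\<alpha> - real n + 1)))"
    unfolding rl_integral_def
  proof (intro set_lebesgue_integral_cong allI impI)
    fix s assume "s \<in> {0<..<t}"
    moreover have "(t - s) powr (real n - \<alpha> - 1) = 1 / (t - s) powr (\<alpha> - real n + 1)"
      by (simp flip: powr_minus_divide)
    ultimately show "rl_kernel (real n - \<alpha>) (t - s) * (deriv ^^ n) f s =
        1 / Gamma (real n - \<alpha>) * ((deriv ^^ n) f s / (t - s) powr (\<alpha> - real n + 1))"
      by (simp add: rl_kernel_def)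
  qed simp
  also have "\<dots> = 1 / Gamma (real n - \<alpha>) *
      (LINT s:{0<..<t}|lborel. (deriv ^^ n) f s / (t - s) powr (\<alpha> - real n + 1))"
    by (rule set_integral_mult_right)
  also have "\<dots> = caputo \<alpha> f t"
    using assms(2) unfolding caputo_def assms(1)[symmetric] Let_def by (simp only: if_False)
  finally show ?thesis
    by (rule sym)
qed

text \<open>
  Applying \<open>I\<^sup>b\<close> to \<open>g = I\<^sup>1\<^sup>-\<^sup>b f'\<close> (with \<open>I\<^sup>0\<close> the identity) gives \<open>I\<^sup>1 f'\<close>, which is \<open>f - f 0\<close> because the
  integrability of \<open>f'\<close> near \<open>0\<close> makes the fundamental theorem of calculus valid up to the origin.
\<close>

lemma caputo_volterra:
  assumes b: "0 < b" "b \<le> 1" and t: "0 < t"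
    and f: "continuous_on {0..} f" "\<And>s. 0 < s \<Longrightarrow> (f has_real_derivative f' s) (at s)"
    and f': "set_integrable lborel {0<..<t} f'"
    and g: "\<And>s. 0 < s \<Longrightarrow> g s = (if b = 1 then f' s else rl_integral (1 - b) f' s)"
  shows "f t = f 0 + rl_integral b g t"
proof (cases "b = 1")
  case True
  then have "rl_integral b g t = (LINT s:{0<..<t}|lborel. f' s)"
    using g by (auto simp: rl_integral_one intro!: set_lebesgue_integral_cong)
  then show ?thesis
    using ftc_integrable[OF t f f'] by simp
next
  case False
  then have "rl_integral b g t = rl_integral b (rl_integral (1 - b) f') t"
    using g by (intro rl_integral_cong) auto
  then show ?thesis
    using ftc_integrable[OF t f f'] rl_integral_semigroup[of b t f'] b False f' by simp
qed

text \<open>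
  The second-order initial condition constrains the one-sided difference quotient at \<open>0\<close>, while the
  Volterra equation needs the limit of the derivative there. Integrability of \<open>f''\<close> provides such a
  limit, and it must then be the one-sided derivative.
\<close>

lemma derivative_limit_at_0:
  fixes f e d :: "real \<Rightarrow> real"
  assumes f: "continuous_on {0..} f" "\<And>s. 0 < s \<Longrightarrow> (f has_real_derivative e s) (at s)"
    and e: "\<And>s. 0 < s \<Longrightarrow> (e has_real_derivative d s) (at s)"
    and d: "set_integrable lborel {0<..<1} d"
    and f0: "(f has_real_derivative C) (at 0 within {0..})"
  shows "continuous_on {0..} (\<lambda>s. if 0 < s then e s else C)"
proof -
  have dint: "d integrable_on {0..1}"
    using set_borel_integral_eq_integral(1)[OF d] by (simp add: integrable_on_Icc_iff_Ioo)
  define E where "E x = integral {0..x} d" for x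
  have contE: "continuous_on {0..1} E"
    unfolding E_def[abs_def] by (rule indefinite_integral_continuous_1[OF dint])
  define L where "L = e 1 - E 1"
  define G where "G s = (if 0 < s then e s else L)" for s
  have "G s = L + E s" if "0 \<le> s" "s \<le> 1" for s
  proof (cases "s = 0")
    case False
    have "(e has_vector_derivative d x) (at x within {s..1})" if "x \<in> {s..1}" for x
    proof -
      have "0 < x"
        using False \<open>0 \<le> s\<close> that by auto
      then have "(e has_real_derivative d x) (at x within {s..1})"
        by (rule has_field_derivative_at_within[OF e])
      then show ?thesis
        by (simp add: has_real_derivative_iff_has_vector_derivative)
    qed
    then have "(d has_integral (e 1 - e s)) {s..1}"
      by (rule fundamental_theorem_of_calculus[OF \<open>s \<le> 1\<close>])
    moreover have "integral {0..s} d + integral {s..1} d = integral {0..1} d"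
      using that dint by (intro Henstock_Kurzweil_Integration.integral_combine) auto
    ultimately show ?thesis
      using False that by (simp add: G_def L_def E_def integral_unique)
  qed (simp add: G_def E_def)
  then have contG: "continuous_on {0..1} G"
    using contE by (subst continuous_on_cong[where g = "\<lambda>s. L + E s"]) (auto intro: continuous_intros)
  have fG: "f s = f 0 + integral {0..s} G" if "0 \<le> s" "s \<le> 1" for s
  proof -
    have "(G has_integral (f s - f 0)) {0..s}"
      using that f by (intro fundamental_theorem_of_calculus_interior)
        (auto intro: continuous_on_subset simp: G_def simp flip: has_real_derivative_iff_has_vector_derivative)
    then show ?thesis
      by (simp add: integral_unique)
  qed
  have "((\<lambda>s. integral {0..s} G) has_real_derivative G 0) (at 0 within {0..1})"
    using contG by (intro integral_has_real_derivative) auto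
  then have "((\<lambda>s. f 0 + integral {0..s} G) has_real_derivative L) (at 0 within {0..1})"
    by (auto intro!: derivative_eq_intros simp: G_def)
  then have 1: "(f has_real_derivative L) (at 0 within {0..1})"
    by (rule has_field_derivative_transform_within[of _ _ _ _ 1]) (auto simp: fG[symmetric])
  have 2: "(f has_real_derivative C) (at 0 within {0..1})"
    using f0 by (rule DERIV_subset) auto
  have "at (0::real) within {0..1} \<noteq> bot"
    by (simp add: at_within_Icc_at_right)
  then have "L = C"
    using 1 2 unfolding has_field_derivative_iff by (rule tendsto_unique)
  have "continuous (at s within {0..}) G" if "0 \<le> s" for s
  proof (cases "s = 0")
    case True
    have "continuous (at 0 within {0..1}) G"
      using contG by (auto simp: continuous_on_eq_continuous_within)
    moreover have "at 0 within {0..1} = at (0::real) within {0..}"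
      by (metis at_within_Icc_at_right at_within_Ici_at_right zero_less_one)
    ultimately show ?thesis
      using True by simp
  next
    case False
    then have "isCont e s"
      using that by (intro DERIV_isCont[OF e]) simp
    moreover have "\<forall>\<^sub>F x in nhds s. G x = e x"
      using eventually_nhds_in_open[of "{0<..}" s] False that
      by (auto simp: G_def elim!: eventually_mono)
    ultimately have "isCont G s"
      by (simp add: isCont_cong)
    then show ?thesis
      by (rule continuous_at_imp_continuous_at_within)
  qed
  then show ?thesis
    unfolding G_def[abs_def] \<open>L = C\<close> by (auto simp: continuous_on_eq_continuous_within)
qed

text \<open>
  The transform is taken of the Volterra equation \<open>f = f 0 + I\<^sup>\<alpha> g\<close> and not of the Caputo equation
  itself: \<open>g\<close> is bounded, but nothing is known about the growth of the derivatives of \<open>f\<close>.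
  For \<open>\<alpha> > 1\<close> the Volterra equation comes in two steps, \<open>f' = I\<^sup>\<alpha>\<^sup>-\<^sup>1 g\<close> and \<open>f = f 0 + I\<^sup>1 f'\<close>.
\<close>

lemma caputo_laplace:
  assumes \<alpha>: "0 < \<alpha>" "\<alpha> \<le> 2" and \<mu>: "0 < \<mu>"
    and f: "caputo_differentiable \<alpha> f"
    and eq: "\<And>t. 0 < t \<Longrightarrow> caputo \<alpha> f t = g t"
    and g: "set_borel_measurable borel {0<..} g" "\<And>t. 0 < t \<Longrightarrow> \<bar>g t\<bar> \<le> C"
    and f0: "1 < \<alpha> \<Longrightarrow> (f has_real_derivative 0) (at 0 within {0..})"
  shows "laplace \<mu> f = f 0 / \<mu> + \<mu> powr (- \<alpha>) * laplace \<mu> g"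
proof -
  note g_int = laplace_integrable_bounded[OF \<mu> g]
  have final: "laplace \<mu> f = f 0 / \<mu> + laplace \<mu> h"
    if "\<And>t. 0 < t \<Longrightarrow> f t = f 0 + h t" "set_integrable lborel {0<..} (\<lambda>t. exp (- \<mu> * t) * h t)" for h
    using laplace_cong[of f "\<lambda>t. f 0 + h t" \<mu>] that laplace_add[OF laplace_const(1)[OF \<mu>] that(2)]
      laplace_const(2)[OF \<mu>] by simp
  have cont: "continuous_on {0..} f"
    using f unfolding caputo_differentiable_def Let_def by blast
  show ?thesis
  proof (cases "\<alpha> \<le> 1")
    case True
    then have n: "nat \<lceil>\<alpha>\<rceil> = 1"
      using \<alpha> by linarith
    have d: "(f has_real_derivative deriv f t) (at t)" "set_integrable lborel {0<..<t} (deriv f)"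
      if "0 < t" for t
      using f that unfolding caputo_differentiable_def Let_def n
      by (auto intro: DERIV_deriv_iff_field_differentiable[THEN iffD2])
    have "g t = (if \<alpha> = 1 then deriv f t else rl_integral (1 - \<alpha>) (deriv f) t)" if "0 < t" for t
      using eq[OF that] caputo_eq_rl_integral[OF n[symmetric], of f t]
      by (auto simp: caputo_def split: if_splits)
    from caputo_volterra[OF \<alpha>(1) True _ cont d(1) d(2) this]
    have "f t = f 0 + rl_integral \<alpha> g t" if "0 < t" for t
      using that by simp
    from final[OF this] show ?thesis
      using laplace_rl_integral[OF \<alpha>(1) \<mu> g_int] by simp
  next
    case False
    then have n: "nat \<lceil>\<alpha>\<rceil> = 2"
      using \<alpha> by linarith
    have d: "(f has_real_derivative deriv f t) (at t)"
        "(deriv f has_real_derivative deriv (deriv f) t) (at t)"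
        "set_integrable lborel {0<..<t} (deriv (deriv f))" if "0 < t" for t
      using f that unfolding caputo_differentiable_def Let_def n
      by (auto intro!: DERIV_deriv_iff_field_differentiable[THEN iffD2] simp: numeral_2_eq_2 less_Suc_eq)
    define e where "e s = (if 0 < s then deriv f s else 0)" for s
    have cont_e: "continuous_on {0..} e"
      using derivative_limit_at_0[OF cont d(1,2,3) f0] False by (simp add: e_def[abs_def])
    have e: "(e has_real_derivative deriv (deriv f) s) (at s)" if "0 < s" for s
      using d(2)[OF that]
      by (rule has_field_derivative_transform_within_open[of _ _ _ "{0<..}"]) (use that in \<open>auto simp: e_def\<close>)
    have b: "0 < \<alpha> - 1" "\<alpha> - 1 \<le> 1"
      using False \<alpha> by auto
    have "g t = (if \<alpha> - 1 = 1 then deriv (deriv f) t else rl_integral (1 - (\<alpha> - 1)) (deriv (deriv f)) t)"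
      if "0 < t" for t
      using eq[OF that] caputo_eq_rl_integral[OF n[symmetric], of f t]
      by (auto simp: caputo_def numeral_2_eq_2 split: if_splits)
    from caputo_volterra[OF b _ cont_e e d(3) this]
    have ee: "e t = rl_integral (\<alpha> - 1) g t" if "0 < t" for t
      using that by (simp add: e_def)
    have "f t = f 0 + rl_integral 1 (rl_integral (\<alpha> - 1) g) t" if "0 < t" for t
    proof -
      have "f t = f 0 + rl_integral 1 e t"
      proof (rule caputo_volterra[OF _ _ that cont])
        show "(f has_real_derivative e s) (at s)" if "0 < s" for s
          using d(1) that by (simp add: e_def)
        have "set_integrable lborel {0..t} e"
          by (rule borel_integrable_atLeastAtMost') (rule continuous_on_subset[OF cont_e], auto)
        then show "set_integrable lborel {0<..<t} e"
          by (rule set_integrable_subset) auto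
      qed auto
      then show ?thesis
        using rl_integral_cong[of t e "rl_integral (\<alpha> - 1) g" 1] ee by simp
    qed
    note 1 = this
    note 2 = laplace_rl_integral[OF b(1) \<mu> g_int]
    note 4 = laplace_rl_integral[OF zero_less_one \<mu> 2(1)]
    have 3: "\<mu> powr (- 1) * (\<mu> powr (- (\<alpha> - 1)) * x) = \<mu> powr (- \<alpha>) * x" for x
      unfolding mult.assoc[symmetric] powr_add[symmetric] by simp
    show ?thesis
      by (simp only: final[OF 1 4(1)] 4(2) 2(2) 3)
  qed
qed

section \<open>Injectivity of the Laplace transform\<close>

text \<open>
  A function whose Laplace transform vanishes at \<open>1, 2, 3, \<dots>\<close> is orthogonal to all polynomials
  in \<open>exp (- t)\<close> with respect to \<open>exp (- t) dt\<close>. The function \<open>exp (- t) * f t\<close> is a continuous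
  function of \<open>exp (- t) \<in> {0..1}\<close>, the factor \<open>exp (- t)\<close> making it vanish at the endpoint \<open>0\<close>, so
  that it is a uniform limit of such polynomials.
\<close>

lemma laplace_eq_0_imp_eq_0:
  fixes f :: "real \<Rightarrow> real"
  assumes cont: "continuous_on {0..} f" and bnd: "\<And>t. 0 \<le> t \<Longrightarrow> \<bar>f t\<bar> \<le> C"
    and lap: "\<And>\<mu>. 0 < \<mu> \<Longrightarrow> laplace \<mu> f = 0" and "0 \<le> t"
  shows "f t = 0"
proof -
  have C: "0 \<le> C" using bnd[of 0] by linarith
  define G where "G x = (if 0 < x then x * f (- ln x) else 0)" for x
  have Gbound: "\<bar>G x\<bar> \<le> C * x" if "0 \<le> x" "x \<le> 1" for x
    using that C bnd[of "- ln x"] by (auto simp: G_def abs_mult mult.commute mult_left_mono)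
  have fm: "set_borel_measurable borel {0<..} f"
    unfolding set_borel_measurable_def
    by (rule borel_measurable_continuous_on_indicator) (auto intro: continuous_on_subset[OF cont])
  have f_int: "set_integrable lborel {0<..} (\<lambda>t. exp (- \<mu> * t) * f t)" if "0 < \<mu>" for \<mu>
    by (rule laplace_integrable_bounded[OF that fm, where C = C]) (simp add: bnd)
  have contG: "continuous_on {0..1} G"
  proof (rule continuous_on_eq_continuous_within[THEN iffD2], rule ballI)
    fix x :: real assume x: "x \<in> {0..1}"
    show "continuous (at x within {0..1}) G"
    proof (cases "x = 0")
      case True
      have "(G \<longlongrightarrow> 0) (at 0 within {0..1})"
      proof (rule tendsto_rabs_zero_cancel, rule tendsto_sandwich[of "\<lambda>_. 0" _ _ "\<lambda>x. C * x"])
        show "((\<lambda>x. C * x) \<longlongrightarrow> 0) (at 0 within {0..1})"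
          by (auto intro!: tendsto_eq_intros)
        show "\<forall>\<^sub>F x in at 0 within {0..1}. \<bar>G x\<bar> \<le> C * x"
          unfolding eventually_at_filter using Gbound by (intro always_eventually) auto
      qed auto
      then show ?thesis
        using True by (simp add: continuous_within G_def)
    next
      case False
      have "continuous_on {0<..1} (\<lambda>x. x * f (- ln x))"
        by (intro continuous_intros continuous_on_compose2[OF cont]) auto
      then have "continuous_on {0<..1} G"
        by (subst continuous_on_cong[OF refl, of _ _ "\<lambda>x. x * f (- ln x)"]) (auto simp: G_def)
      then have "continuous (at x within {0<..1}) G"
        using x False by (auto simp: continuous_on_eq_continuous_within)
      moreover have "at x within {0<..1} = at x within {0..1}"
        using x False by (intro at_within_nhd[of _ "{0<..}"]) auto
      ultimately show ?thesis
        by simp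
    qed
  qed
  have poly0: "laplace 1 (\<lambda>t. p (exp (- t)) * f t) = 0"
    "set_integrable lborel {0<..} (\<lambda>t. exp (- 1 * t) * (p (exp (- t)) * f t))"
    if "real_polynomial_function p" for p
  proof -
    obtain a n where p: "p = (\<lambda>x. \<Sum>i\<le>n. a i * x ^ i)"
      using \<open>real_polynomial_function p\<close> real_polynomial_function_iff_sum by auto
    have mon: "exp (- 1 * t) * (a i * exp (- t) ^ i * f t) = a i * (exp (- (real i + 1) * t) * f t)" for i t
      by (simp add: algebra_simps flip: exp_of_nat_mult exp_add)
    have eq: "exp (- 1 * t) * (p (exp (- t)) * f t) = (\<Sum>i\<le>n. a i * (exp (- (real i + 1) * t) * f t))" for t
      by (simp only: p sum_distrib_left sum_distrib_right mon)
    have int: "set_integrable lborel {0<..} (\<lambda>t. a i * (exp (- (real i + 1) * t) * f t))" for i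
      using f_int[of "real i + 1"] by simp
    show "set_integrable lborel {0<..} (\<lambda>t. exp (- 1 * t) * (p (exp (- t)) * f t))"
      using int unfolding eq set_integrable_def scaleR_sum_right
      by (intro Bochner_Integration.integrable_sum)
    have "laplace 1 (\<lambda>t. p (exp (- t)) * f t) = (\<Sum>i\<le>n. LINT t:{0<..}|lborel. a i * (exp (- (real i + 1) * t) * f t))"
      using int unfolding laplace_def eq set_lebesgue_integral_def set_integrable_def scaleR_sum_right
      by (intro Bochner_Integration.integral_sum)
    also have "\<dots> = (\<Sum>i\<le>n. a i * laplace (real i + 1) f)"
      by (simp add: laplace_def)
    also have "\<dots> = 0"
      using lap by simp
    finally show "laplace 1 (\<lambda>t. p (exp (- t)) * f t) = 0" .
  qed
  have int2: "set_integrable lborel {0<..} (\<lambda>t. exp (- 2 * t) * (f t)\<^sup>2)"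
  proof (rule laplace_integrable_bounded)
    have "(\<lambda>t. (indicator {0<..} t *\<^sub>R f t) * (indicator {0<..} t *\<^sub>R f t)) \<in> borel_measurable borel"
      using fm unfolding set_borel_measurable_def by measurable
    then show "set_borel_measurable borel {0<..} (\<lambda>t. (f t)\<^sup>2)"
      unfolding set_borel_measurable_def
      by (rule measurable_cong[THEN iffD1, rotated]) (auto simp: indicator_def power2_eq_square)
    show "\<bar>(f t)\<^sup>2\<bar> \<le> C\<^sup>2" if "0 < t" for t
      using bnd[of t] that by (simp add: abs_le_square_iff[symmetric])
  qed simp
  define I where "I = laplace 2 (\<lambda>t. (f t)\<^sup>2)"
  \<comment> \<open>The integrand of \<open>I\<close> is \<open>exp (- t) * f t * G (exp (- t))\<close>, and \<open>G\<close> can be replaced by a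
      polynomial at the cost of \<open>e\<close>.\<close>
  have I_le: "I \<le> C * e" if "0 < e" for e
  proof -
    obtain p where p: "real_polynomial_function p" "\<And>x. x \<in> {0..1} \<Longrightarrow> \<bar>G x - p x\<bar> < e"
      using Stone_Weierstrass_real_polynomial_function[OF _ contG \<open>0 < e\<close>] by auto
    have "I = I - laplace 1 (\<lambda>t. p (exp (- t)) * f t)"
      using poly0(1)[OF p(1)] by simp
    also have "\<dots> = (LINT t:{0<..}|lborel. exp (- 2 * t) * (f t)\<^sup>2 - exp (- 1 * t) * (p (exp (- t)) * f t))"
      unfolding I_def laplace_def using int2 poly0(2)[OF p(1)] by (intro set_integral_diff(2)[symmetric])
    also have "\<dots> \<le> (LINT t:{0<..}|lborel. exp (- 1 * t) * (C * e))"
    proof (rule set_integral_mono)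
      show "set_integrable lborel {0<..} (\<lambda>t. exp (- 2 * t) * (f t)\<^sup>2 - exp (- 1 * t) * (p (exp (- t)) * f t))"
        using int2 poly0(2)[OF p(1)] by (intro set_integral_diff(1))
      show "set_integrable lborel {0<..} (\<lambda>t. exp (- 1 * t) * (C * e))"
        by (rule laplace_const) simp
      fix t :: real assume "t \<in> {0<..}"
      then have t: "0 < t" by simp
      have "exp (- 2 * t) = exp (- t) * exp (- t)"
        by (simp flip: exp_add)
      then have "exp (- 2 * t) * (f t)\<^sup>2 - exp (- 1 * t) * (p (exp (- t)) * f t)
          = exp (- 1 * t) * (f t * (G (exp (- t)) - p (exp (- t))))"
        by (simp add: G_def power2_eq_square algebra_simps)
      also have "f t * (G (exp (- t)) - p (exp (- t))) \<le> \<bar>f t\<bar> * \<bar>G (exp (- t)) - p (exp (- t))\<bar>"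
        by (simp flip: abs_mult)
      also have "\<dots> \<le> C * e"
        using bnd[of t] p(2)[of "exp (- t)"] t C by (intro mult_mono) auto
      finally show "exp (- 2 * t) * (f t)\<^sup>2 - exp (- 1 * t) * (p (exp (- t)) * f t) \<le> exp (- 1 * t) * (C * e)"
        by simp
    qed
    also have "\<dots> = C * e"
      using laplace_const(2)[of 1 "C * e"] by (simp add: laplace_def)
    finally show ?thesis .
  qed
  have "I \<le> 0"
  proof (rule field_le_epsilon)
    fix e :: real assume "0 < e"
    have "I \<le> C * (e / (C + 1))"
      using C \<open>0 < e\<close> by (intro I_le) auto
    also have "\<dots> \<le> e"
      using C \<open>0 < e\<close> by (simp add: field_simps)
    finally show "I \<le> 0 + e" by simp
  qed
  define h where "h s = exp (- 2 * s) * (f s)\<^sup>2" for s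
  have conth: "continuous_on {0..t + 1} h"
    unfolding h_def by (intro continuous_intros continuous_on_subset[OF cont]) auto
  have "set_integrable lborel {0<..<t + 1} h"
    using int2 unfolding h_def by (rule set_integrable_subset) auto
  note hint = set_borel_integral_eq_integral[OF this]
  have "(LINT s:{0<..<t + 1}|lborel. h s) \<le> I"
    unfolding I_def laplace_def h_def[symmetric] set_lebesgue_integral_def
    using int2 \<open>set_integrable lborel {0<..<t + 1} h\<close>
    by (intro integral_mono) (auto simp: set_integrable_def h_def indicator_def)
  moreover have "0 \<le> (LINT s:{0<..<t + 1}|lborel. h s)"
    unfolding set_lebesgue_integral_def by (intro integral_nonneg_AE) (auto simp: h_def)
  ultimately have "integral {0<..<t + 1} h = 0"
    using \<open>I \<le> 0\<close> hint(2) by linarith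
  then have "(h has_integral 0) {0<..<t + 1}"
    using hint(1) by (simp add: has_integral_integrable_integral)
  then have "(h has_integral 0) (cbox 0 (t + 1))"
    by (simp add: has_integral_Icc_iff_Ioo)
  then have "h t = 0"
    using conth \<open>0 \<le> t\<close> by (intro has_integral_0_cbox_imp_0[of 0 "t + 1" h t]) (auto simp: h_def box_real)
  then show ?thesis
    by (simp add: h_def)
qed

section \<open>Smooth functions and cutoffs\<close>

text \<open>
  The recursion takes one derivative off the inside of \<open>(deriv ^^ n) f\<close>. An induction can then
  replace \<open>f\<close> by its derivative, which is what the Leibniz rule needs.
\<close>

primrec smooth_upto :: "nat \<Rightarrow> (real \<Rightarrow> real) \<Rightarrow> bool" where
  "smooth_upto 0 f \<longleftrightarrow> (\<forall>x. f field_differentiable (at x))"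
| "smooth_upto (Suc n) f \<longleftrightarrow> (\<forall>x. f field_differentiable (at x)) \<and> smooth_upto n (deriv f)"

definition smooth :: "(real \<Rightarrow> real) \<Rightarrow> bool" where
  "smooth f \<longleftrightarrow> (\<forall>n x. (deriv ^^ n) f field_differentiable (at x))"

lemma smooth_upto_iff: "smooth_upto n f \<longleftrightarrow> (\<forall>k\<le>n. \<forall>x. (deriv ^^ k) f field_differentiable (at x))"
proof (induction n arbitrary: f)
  case (Suc n)
  have "(\<forall>k\<le>Suc n. \<forall>x. (deriv ^^ k) f field_differentiable (at x)) \<longleftrightarrow>
      (\<forall>x. f field_differentiable (at x)) \<and> (\<forall>k\<le>n. \<forall>x. (deriv ^^ Suc k) f field_differentiable (at x))"
    using All_less_Suc2[of "Suc n" "\<lambda>k. \<forall>x. (deriv ^^ k) f field_differentiable (at x)"]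
    by (simp only: less_Suc_eq_le funpow_0)
  then show ?case
    by (simp add: Suc funpow_swap1)
qed simp

lemma smooth_iff_upto: "smooth f \<longleftrightarrow> (\<forall>n. smooth_upto n f)"
  unfolding smooth_def smooth_upto_iff by blast

lemma smooth_derivs:
  assumes "smooth f"
  shows "(f has_real_derivative deriv f x) (at x)"
    and "smooth (deriv f)"
proof -
  show "(f has_real_derivative deriv f x) (at x)"
    using assms[unfolded smooth_def, rule_format, of 0 x] by (simp add: DERIV_deriv_iff_field_differentiable)
  show "smooth (deriv f)"
    unfolding smooth_def
  proof (intro allI)
    fix n x
    show "(deriv ^^ n) (deriv f) field_differentiable (at x)"
      using assms[unfolded smooth_def, rule_format, of "Suc n" x] by (simp add: funpow_swap1)
  qed
qed

lemma smooth_isCont: "smooth f \<Longrightarrow> isCont f x"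
  using smooth_derivs(1) DERIV_isCont by blast

lemma smooth_coinduct:
  assumes "P f" and step: "\<And>f. P f \<Longrightarrow> (\<exists>f'. (\<forall>x. (f has_real_derivative f' x) (at x)) \<and> P f')"
  shows "smooth f"
proof -
  have "smooth_upto n f" if "P f" for n f
    using that
  proof (induction n arbitrary: f)
    case 0
    then show ?case using step[of f] by (auto simp: field_differentiable_def)
  next
    case (Suc n)
    then obtain f' where f': "\<And>x. (f has_real_derivative f' x) (at x)" "P f'"
      using step by blast
    then have "deriv f = f'"
      by (auto intro: DERIV_imp_deriv)
    then show ?case
      using f' Suc.IH by (auto simp: field_differentiable_def)
  qed
  then show ?thesis
    using \<open>P f\<close> by (simp add: smooth_iff_upto)
qed

lemma smooth_upto_add: "smooth_upto n f \<Longrightarrow> smooth_upto n g \<Longrightarrow> smooth_upto n (\<lambda>x. f x + g x)"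
proof (induction n arbitrary: f g)
  case (Suc n)
  then have "deriv (\<lambda>x. f x + g x) = (\<lambda>x. deriv f x + deriv g x)"
    by (auto intro!: DERIV_imp_deriv DERIV_add simp: DERIV_deriv_iff_field_differentiable)
  then show ?case
    using Suc by (auto intro: field_differentiable_add)
qed (auto intro: field_differentiable_add)

lemma smooth_mult:
  assumes "smooth f" "smooth g"
  shows "smooth (\<lambda>x. f x * g x)"
proof -
  have "smooth_upto n (\<lambda>x. f x * g x)" for n
    using assms
  proof (induction n arbitrary: f g)
    case 0
    then show ?case
      by (auto intro!: field_differentiable_mult simp: smooth_iff_upto dest: spec[of _ 0])
  next
    case (Suc n)
    note d = smooth_derivs(1)[OF Suc.prems(1)] smooth_derivs(1)[OF Suc.prems(2)]
    have 1: "((\<lambda>x. f x * g x) has_real_derivative deriv f x * g x + f x * deriv g x) (at x)" for x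
      using DERIV_mult[OF d] by (simp add: mult.commute add.commute)
    then have "deriv (\<lambda>x. f x * g x) = (\<lambda>x. deriv f x * g x + f x * deriv g x)"
      by (auto intro: DERIV_imp_deriv)
    moreover have "smooth_upto n (\<lambda>x. deriv f x * g x + f x * deriv g x)"
      by (intro smooth_upto_add Suc.IH Suc.prems smooth_derivs)
    ultimately show ?case
      using 1 by (auto simp: field_differentiable_def)
  qed
  then show ?thesis
    by (simp add: smooth_iff_upto)
qed

lemma smooth_affine:
  assumes "smooth f"
  shows "smooth (\<lambda>x. f (a * x + b))"
proof (rule smooth_coinduct[where P = "\<lambda>h. \<exists>f c. smooth f \<and> h = (\<lambda>x. c * f (a * x + b))"])
  show "\<exists>g c. smooth g \<and> (\<lambda>x. f (a * x + b)) = (\<lambda>x. c * g (a * x + b))"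
    using assms by (intro exI[of _ f] exI[of _ 1]) simp
  fix h assume "\<exists>f c. smooth f \<and> h = (\<lambda>x. c * f (a * x + b))"
  then obtain f c where f: "smooth f" and h: "h = (\<lambda>x. c * f (a * x + b))"
    by blast
  have "(h has_real_derivative (c * a) * deriv f (a * x + b)) (at x)" for x
    unfolding h by (auto intro!: derivative_eq_intros DERIV_chain2[OF smooth_derivs(1)[OF f]])
  then show "\<exists>h'. (\<forall>x. (h has_real_derivative h' x) (at x)) \<and>
      (\<exists>f c. smooth f \<and> h' = (\<lambda>x. c * f (a * x + b)))"
    using smooth_derivs(2)[OF f]
    by (intro exI[of _ "\<lambda>x. (c * a) * deriv f (a * x + b)"] conjI allI exI[of _ "deriv f"] exI[of _ "c * a"]) auto
qed

lemma smooth_trig: "smooth (\<lambda>x. a * cos (\<xi> * x) + b * sin (\<xi> * x))"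
proof (rule smooth_coinduct[where P = "\<lambda>h. \<exists>a b. h = (\<lambda>x. a * cos (\<xi> * x) + b * sin (\<xi> * x))"])
  fix h assume "\<exists>a b. h = (\<lambda>x. a * cos (\<xi> * x) + b * sin (\<xi> * x))"
  then obtain a b where h: "h = (\<lambda>x. a * cos (\<xi> * x) + b * sin (\<xi> * x))"
    by blast
  have "(h has_real_derivative (b * \<xi>) * cos (\<xi> * x) + (- a * \<xi>) * sin (\<xi> * x)) (at x)" for x
    unfolding h by (auto intro!: derivative_eq_intros)
  then show "\<exists>h'. (\<forall>x. (h has_real_derivative h' x) (at x)) \<and>
      (\<exists>a b. h' = (\<lambda>x. a * cos (\<xi> * x) + b * sin (\<xi> * x)))"
    by (intro exI[of _ "\<lambda>x. (b * \<xi>) * cos (\<xi> * x) + (- a * \<xi>) * sin (\<xi> * x)"] conjI allI exI[of _ "b * \<xi>"] exI[of _ "- a * \<xi>"]) auto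
qed blast

text \<open>
  The derivatives of \<open>exp (- 1 / x)\<close> are of the form \<open>P (1 / x) * exp (- 1 / x)\<close> for a polynomial
  \<open>P\<close>; this family is closed under differentiation, also at the origin.
\<close>

definition flat_exp :: "real poly \<Rightarrow> real \<Rightarrow> real" where
  "flat_exp P x = (if 0 < x then poly P (1 / x) * exp (- (1 / x)) else 0)"

lemma poly_exp_tendsto_0: "((\<lambda>y. poly P y * exp (- y)) \<longlongrightarrow> (0::real)) at_top"
proof -
  have "((\<lambda>y. \<Sum>i\<le>degree P. coeff P i * (y ^ i / exp y)) \<longlongrightarrow> (\<Sum>i\<le>degree P. coeff P i * 0)) at_top"
    by (intro tendsto_sum tendsto_mult tendsto_const tendsto_power_div_exp_0)
  moreover have "poly P y * exp (- y) = (\<Sum>i\<le>degree P. coeff P i * (y ^ i / exp y))" for y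
    by (simp add: poly_altdef sum_distrib_right exp_minus divide_inverse mult.assoc)
  ultimately show ?thesis
    by simp
qed

lemma flat_deriv:
  "(flat_exp P has_real_derivative flat_exp ([:0, 0, 1:] * (P - pderiv P)) x) (at x)"
proof -
  consider "x > 0" | "x < 0" | "x = 0" by linarith
  then show ?thesis
  proof cases
    case 1
    have "((\<lambda>x. poly P (1 / x) * exp (- (1 / x))) has_real_derivative
        flat_exp ([:0, 0, 1:] * (P - pderiv P)) x) (at x)"
      using 1 by (auto intro!: derivative_eq_intros DERIV_chain2[OF poly_DERIV]
        simp: flat_exp_def algebra_simps power2_eq_square)
    then show ?thesis
      by (rule has_field_derivative_transform_within_open[of _ _ _ "{0<..}"])
        (use 1 in \<open>auto simp: flat_exp_def\<close>)
  next
    case 2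
    have "((\<lambda>x. 0) has_real_derivative flat_exp ([:0, 0, 1:] * (P - pderiv P)) x) (at x)"
      using 2 by (simp add: flat_exp_def)
    then show ?thesis
      by (rule has_field_derivative_transform_within_open[of _ _ _ "{..<0}"])
        (use 2 in \<open>auto simp: flat_exp_def\<close>)
  next
    case 3
    have "((\<lambda>h. flat_exp P h / h) \<longlongrightarrow> 0) (at_right 0)"
    proof (rule Lim_transform_eventually)
      show "((\<lambda>h. poly ([:0, 1:] * P) (inverse h) * exp (- inverse h)) \<longlongrightarrow> 0) (at_right 0)"
        by (rule filterlim_compose[OF poly_exp_tendsto_0 filterlim_inverse_at_top_right])
      show "\<forall>\<^sub>F h in at_right 0. poly ([:0, 1:] * P) (inverse h) * exp (- inverse h) = flat_exp P h / h"
        using eventually_at_right_less[of 0]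
        by eventually_elim (simp add: flat_exp_def field_simps inverse_eq_divide)
    qed
    moreover have "((\<lambda>h. flat_exp P h / h) \<longlongrightarrow> 0) (at_left 0)"
      by (rule Lim_transform_eventually[of "\<lambda>_. 0"])
        (auto simp: flat_exp_def eventually_at_left_field intro!: exI[of _ "-1"])
    ultimately have "((\<lambda>h. flat_exp P h / h) \<longlongrightarrow> 0) (at 0)"
      by (simp add: filterlim_split_at)
    then show ?thesis
      using 3 by (simp add: has_field_derivative_iff flat_exp_def)
  qed
qed

lemma smooth_flat_exp: "smooth (flat_exp P)"
proof (rule smooth_coinduct[where P = "\<lambda>h. \<exists>P. h = flat_exp P"])
  fix h assume "\<exists>P. h = flat_exp P"
  then show "\<exists>h'. (\<forall>x. (h has_real_derivative h' x) (at x)) \<and> (\<exists>P. h' = flat_exp P)"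
    using flat_deriv by blast
qed blast

text \<open>The factor \<open>exp 2\<close> normalises the maximum, attained at \<open>0\<close>, to \<open>1\<close>.\<close>

definition bump :: "real \<Rightarrow> real" where
  "bump x = exp 2 * (flat_exp 1 (1 - x) * flat_exp 1 (1 + x))"

lemma bump_smooth: "smooth bump"
proof -
  have "smooth (\<lambda>x. flat_exp 1 (-1 * x + 1) * flat_exp 1 (1 * x + 1))"
    by (intro smooth_mult smooth_affine smooth_flat_exp)
  moreover have "smooth (\<lambda>x. exp 2)"
    using smooth_trig[of "exp 2" 0 0] by simp
  ultimately have "smooth (\<lambda>x. exp 2 * (flat_exp 1 (-1 * x + 1) * flat_exp 1 (1 * x + 1)))"
    by (rule smooth_mult[rotated])
  then show ?thesis
    by (simp add: bump_def[abs_def] add.commute)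
qed

lemma bump_0: "bump 0 = 1"
  by (simp add: bump_def flat_exp_def flip: exp_add)

lemma bump_outside: "1 \<le> \<bar>x\<bar> \<Longrightarrow> bump x = 0"
  by (auto simp: bump_def flat_exp_def)

lemma bump_range: "0 \<le> bump x" "bump x \<le> 1"
proof -
  show "0 \<le> bump x"
    by (simp add: bump_def flat_exp_def)
  show "bump x \<le> 1"
  proof (cases "\<bar>x\<bar> < 1")
    case True
    then have "-1 < x" "x < 1"
      by auto
    from True have "x\<^sup>2 < 1"
      by (simp add: abs_square_less_1)
    have "1 / (1 - x) + 1 / (1 + x) = 2 / (1 - x\<^sup>2)"
      using \<open>-1 < x\<close> \<open>x < 1\<close> by (auto simp: field_simps power2_eq_square)
    also have "2 \<le> 2 / (1 - x\<^sup>2)"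
      using \<open>x\<^sup>2 < 1\<close> by (simp add: field_simps)
    finally have "2 - (1 / (1 - x) + 1 / (1 + x)) \<le> 0"
      by simp
    moreover have "bump x = exp (2 - (1 / (1 - x) + 1 / (1 + x)))"
      using \<open>-1 < x\<close> \<open>x < 1\<close> by (simp add: bump_def flat_exp_def flip: exp_add)
    ultimately show ?thesis
      by simp
  next
    case False
    then show ?thesis by (simp add: bump_outside)
  qed
qed

lemma bounded_if_zero_outside:
  fixes f :: "real \<Rightarrow> real"
  assumes "\<And>x. isCont f x" "\<And>x. R < \<bar>x\<bar> \<Longrightarrow> f x = 0"
  shows "\<exists>B. \<forall>x. \<bar>f x\<bar> \<le> B"
proof -
  have "compact (f ` {-R..R})"
    using assms(1) by (intro compact_continuous_image continuous_at_imp_continuous_on) auto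
  then obtain B where B: "\<And>x. x \<in> {-R..R} \<Longrightarrow> \<bar>f x\<bar> \<le> B"
    by (meson bounded_real compact_imp_bounded imageI)
  have "\<bar>f x\<bar> \<le> max 0 B" for x
  proof (cases "R < \<bar>x\<bar>")
    case True
    then show ?thesis
      using assms(2)[of x] by simp
  next
    case False
    then show ?thesis
      by (intro max.coboundedI2 B) auto
  qed
  then show ?thesis by blast
qed

lemma deriv_zero_outside:
  fixes f :: "real \<Rightarrow> real"
  assumes "\<And>x. R < \<bar>x\<bar> \<Longrightarrow> f x = 0" "R < \<bar>x\<bar>"
  shows "deriv f x = 0"
proof -
  have "((\<lambda>_. 0) has_real_derivative 0) (at x)"
    by simp
  then have "(f has_real_derivative 0) (at x)"
    by (rule has_field_derivative_transform_within_open[of _ _ _ "{y. R < \<bar>y\<bar>}"])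
      (use assms in \<open>auto intro!: open_Collect_less continuous_intros\<close>)
  then show ?thesis
    by (rule DERIV_imp_deriv)
qed

lemma bump_derivs_bounded:
  obtains B where "\<And>x. \<bar>bump x\<bar> \<le> B" "\<And>x. \<bar>deriv bump x\<bar> \<le> B" "\<And>x. \<bar>deriv (deriv bump) x\<bar> \<le> B"
proof -
  note s1 = smooth_derivs(2)[OF bump_smooth]
  note s2 = smooth_derivs(2)[OF s1]
  have z0: "bump x = 0" if "1 < \<bar>x\<bar>" for x
    using that by (simp add: bump_outside)
  note z1 = deriv_zero_outside[where R = 1, OF z0]
  note z2 = deriv_zero_outside[where R = 1, OF z1]
  obtain B1 where B1: "\<And>x. \<bar>deriv bump x\<bar> \<le> B1"
    using bounded_if_zero_outside[where R = 1, OF smooth_isCont[OF s1] z1] by blast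
  obtain B2 where B2: "\<And>x. \<bar>deriv (deriv bump) x\<bar> \<le> B2"
    using bounded_if_zero_outside[where R = 1, OF smooth_isCont[OF s2] z2] by blast
  show thesis
  proof (rule that[of "max 1 (max B1 B2)"])
    show "\<bar>bump x\<bar> \<le> max 1 (max B1 B2)" for x
      using bump_range[of x] by (simp add: le_max_iff_disj)
  qed (use B1 B2 in \<open>auto simp: le_max_iff_disj\<close>)
qed

definition cutoff :: "real \<Rightarrow> (real \<Rightarrow> real) \<Rightarrow> real \<Rightarrow> real" where
  "cutoff R \<phi> x = \<phi> x * bump (x / R)"

lemma bump_rescaled_smooth: "smooth (\<lambda>x. bump (x / R))"
  using smooth_affine[OF bump_smooth, of "1 / R" 0] by simp

lemma test_function_iff: "test_function \<phi> \<longleftrightarrow> smooth \<phi> \<and> (\<exists>R. \<forall>x. \<bar>x\<bar> > R \<longrightarrow> \<phi> x = 0)"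
  unfolding test_function_def smooth_def by blast

lemma cutoff_test_function:
  assumes "smooth \<phi>" "0 < R"
  shows "test_function (cutoff R \<phi>)"
  unfolding test_function_iff
proof
  show "smooth (cutoff R \<phi>)"
    unfolding cutoff_def[abs_def] by (intro smooth_mult assms bump_rescaled_smooth)
  show "\<exists>S. \<forall>x. \<bar>x\<bar> > S \<longrightarrow> cutoff R \<phi> x = 0"
    using assms by (intro exI[of _ R]) (auto simp: cutoff_def abs_divide intro!: bump_outside)
qed

lemma cutoff_deriv2:
  assumes "smooth \<phi>" "0 < R"
  shows "(deriv ^^ 2) (cutoff R \<phi>) x = deriv (deriv \<phi>) x * bump (x / R)
    + 2 * deriv \<phi> x * deriv bump (x / R) / R + \<phi> x * deriv (deriv bump) (x / R) / R\<^sup>2"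
proof -
  note s = smooth_derivs(1)[OF assms(1)] smooth_derivs(1)[OF smooth_derivs(2)[OF assms(1)]]
  note b = smooth_derivs(1)[OF bump_smooth] smooth_derivs(1)[OF smooth_derivs(2)[OF bump_smooth]]
  have b1: "((\<lambda>x. bump (x / R)) has_real_derivative deriv bump (x / R) / R) (at x)" for x
    using DERIV_chain2[OF b(1) DERIV_cdivide[OF DERIV_ident]] by simp
  have b2: "((\<lambda>x. deriv bump (x / R)) has_real_derivative deriv (deriv bump) (x / R) / R) (at x)" for x
    using DERIV_chain2[OF b(2) DERIV_cdivide[OF DERIV_ident]] by simp
  have "(cutoff R \<phi> has_real_derivative deriv \<phi> x * bump (x / R) + \<phi> x * (deriv bump (x / R) / R)) (at x)" for x
    unfolding cutoff_def[abs_def]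
    by (auto intro!: derivative_eq_intros b1 s)
  then have 1: "deriv (cutoff R \<phi>) = (\<lambda>x. deriv \<phi> x * bump (x / R) + \<phi> x * (deriv bump (x / R) / R))"
    by (auto intro: DERIV_imp_deriv)
  have "deriv (\<lambda>x. deriv \<phi> x * bump (x / R) + \<phi> x * (deriv bump (x / R) / R)) x =
     deriv (deriv \<phi>) x * bump (x / R)
    + 2 * deriv \<phi> x * deriv bump (x / R) / R + \<phi> x * deriv (deriv bump) (x / R) / R\<^sup>2"
    by (rule DERIV_imp_deriv)
      (auto intro!: derivative_eq_intros b1 b2 s
        simp: power2_eq_square field_simps \<open>0 < R\<close>[THEN less_imp_neq, symmetric])
  then show ?thesis
    by (simp add: numeral_2_eq_2 1)
qed

lemma test_function_bounded:
  assumes "test_function \<phi>"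
  shows "\<exists>B. \<forall>x. \<bar>\<phi> x\<bar> \<le> B"
proof -
  obtain R where "\<And>x. R < \<bar>x\<bar> \<Longrightarrow> \<phi> x = 0" and "smooth \<phi>"
    using assms unfolding test_function_iff by blast
  then show ?thesis
    using bounded_if_zero_outside[of \<phi> R] smooth_isCont by simp
qed

lemma test_function_deriv:
  assumes "test_function \<phi>"
  shows "test_function (deriv \<phi>)"
proof -
  obtain R where R: "\<And>x. R < \<bar>x\<bar> \<Longrightarrow> \<phi> x = 0" and "smooth \<phi>"
    using assms unfolding test_function_iff by blast
  then have "smooth (deriv \<phi>)"
    by (simp add: smooth_derivs)
  moreover have "deriv \<phi> x = 0" if "R < \<bar>x\<bar>" for x
    using deriv_zero_outside[OF R that] .
  ultimately show ?thesis
    unfolding test_function_iff by auto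
qed

section \<open>The fundamental solution as a weakly continuous kernel\<close>

lemma fundamental_solution_real_distribution:
  assumes "fundamental_solution \<alpha> U" "0 \<le> t"
  shows "real_distribution (U t)"
  using conjunct1[OF assms(1)[unfolded fundamental_solution_def]] assms(2)
  by (simp add: real_distribution_def real_distribution_axioms_def)

lemma (in real_distribution) integrable_bounded:
  fixes f :: "real \<Rightarrow> real"
  assumes "f \<in> borel_measurable borel" "\<And>x. \<bar>f x\<bar> \<le> B"
  shows "integrable M f"
  using assms by (intro integrable_const_bound[of _ B]) auto

lemma (in real_distribution) integral_abs_le:
  fixes f :: "real \<Rightarrow> real"
  assumes "f \<in> borel_measurable borel" "\<And>x. \<bar>f x\<bar> \<le> B"
  shows "\<bar>integral\<^sup>L M f\<bar> \<le> B"
proof -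
  have "\<bar>integral\<^sup>L M f\<bar> \<le> (\<integral>x. \<bar>f x\<bar> \<partial>M)"
    by (rule integral_abs_bound)
  also have "\<dots> \<le> (\<integral>x. B \<partial>M)"
    using assms integrable_bounded[OF assms] by (intro integral_mono) auto
  also have "\<dots> = B"
    using prob_space by simp
  finally show ?thesis .
qed

lemma smooth_measurable: "smooth f \<Longrightarrow> f \<in> borel_measurable borel"
  by (intro borel_measurable_continuous_onI continuous_at_imp_continuous_on ballI smooth_isCont)

lemma test_function_measurable: "test_function f \<Longrightarrow> f \<in> borel_measurable borel"
  unfolding test_function_iff by (elim conjE) (rule smooth_measurable)

lemma fundamental_solution_test:
  assumes U: "fundamental_solution \<alpha> U" and \<phi>: "test_function \<phi>"
  shows "continuous_on {0..} (\<lambda>t. LINT s|U t. \<phi> s)"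
    and "0 < \<alpha> \<Longrightarrow> \<alpha> \<le> 2 \<Longrightarrow> 0 < \<mu> \<Longrightarrow> laplace \<mu> (\<lambda>t. LINT s|U t. \<phi> s) =
      \<phi> 0 / \<mu> + \<mu> powr (- \<alpha>) * laplace \<mu> (\<lambda>t. LINT s|U t. (deriv ^^ 2) \<phi> s)"
proof -
  note fs = U[unfolded fundamental_solution_def Let_def, THEN conjunct2, THEN conjunct2, THEN spec, THEN mp]
  have cont: "continuous_on {0..} (\<lambda>t. LINT s|U t. \<psi> s)" if "test_function \<psi>" for \<psi>
    using conjunct1[OF fs[OF that]] by (simp only: caputo_differentiable_def Let_def)
  show "continuous_on {0..} (\<lambda>t. LINT s|U t. \<phi> s)"
    using \<phi> by (rule cont)
  assume \<alpha>: "0 < \<alpha>" "\<alpha> \<le> 2" and \<mu>: "0 < \<mu>"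
  have \<phi>'': "test_function ((deriv ^^ 2) \<phi>)"
    using \<phi> by (simp add: numeral_2_eq_2 test_function_deriv)
  then obtain B where B: "\<And>x. \<bar>(deriv ^^ 2) \<phi> x\<bar> \<le> B"
    using test_function_bounded by blast
  have "U 0 = return borel 0"
    using U[unfolded fundamental_solution_def] by (elim conjE)
  then have h0: "(LINT s|U 0. \<phi> s) = \<phi> 0"
    using test_function_measurable[OF \<phi>] by (simp add: integral_return)
  have "laplace \<mu> (\<lambda>t. LINT s|U t. \<phi> s) =
      (LINT s|U 0. \<phi> s) / \<mu> + \<mu> powr (- \<alpha>) * laplace \<mu> (\<lambda>t. LINT s|U t. (deriv ^^ 2) \<phi> s)"
  proof (rule caputo_laplace[OF \<alpha> \<mu>])
    show "caputo_differentiable \<alpha> (\<lambda>t. LINT s|U t. \<phi> s)"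
      "\<And>t. 0 < t \<Longrightarrow> caputo \<alpha> (\<lambda>t. LINT s|U t. \<phi> s) t = (LINT s|U t. (deriv ^^ 2) \<phi> s)"
      "1 < \<alpha> \<Longrightarrow> ((\<lambda>t. LINT s|U t. \<phi> s) has_real_derivative 0) (at 0 within {0..})"
      using fs[OF \<phi>] by simp_all
    show "set_borel_measurable borel {0<..} (\<lambda>t. LINT s|U t. (deriv ^^ 2) \<phi> s)"
      unfolding set_borel_measurable_def
      by (rule borel_measurable_continuous_on_indicator) (auto intro: continuous_on_subset[OF cont[OF \<phi>'']])
    show "\<bar>LINT s|U t. (deriv ^^ 2) \<phi> s\<bar> \<le> B" if "0 < t" for t
      using that by (intro real_distribution.integral_abs_le fundamental_solution_real_distribution[OF U]
          test_function_measurable[OF \<phi>''] B) simp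
  qed
  then show "laplace \<mu> (\<lambda>t. LINT s|U t. \<phi> s) =
      \<phi> 0 / \<mu> + \<mu> powr (- \<alpha>) * laplace \<mu> (\<lambda>t. LINT s|U t. (deriv ^^ 2) \<phi> s)"
    by (simp only: h0)
qed

lemma (in real_distribution) integral_bump_tendsto:
  "(\<lambda>n. LINT s|M. bump (s / real (Suc n))) \<longlonglongrightarrow> 1"
proof -
  have "(\<lambda>n. LINT s|M. bump (s / real (Suc n))) \<longlonglongrightarrow> (LINT s|M. 1)"
  proof (rule integral_dominated_convergence[where w = "\<lambda>_. 1"])
    show "(\<lambda>s. bump (s / real (Suc n))) \<in> borel_measurable M" for n
      using smooth_measurable[OF bump_rescaled_smooth] by simp
    show "AE s in M. (\<lambda>n. bump (s / real (Suc n))) \<longlonglongrightarrow> 1"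
    proof (rule AE_I2)
      fix s
      have "(\<lambda>n. s / real (Suc n)) \<longlonglongrightarrow> 0"
        using tendsto_mult[OF tendsto_const LIMSEQ_inverse_real_of_nat] by (simp add: divide_inverse)
      then show "(\<lambda>n. bump (s / real (Suc n))) \<longlonglongrightarrow> 1"
        using isCont_tendsto_compose[OF smooth_isCont[OF bump_smooth, of 0]] bump_0 by simp
    qed
  qed (use bump_range in auto)
  then show ?thesis
    using prob_space by simp
qed

text \<open>
  The definition controls \<open>U t\<close> on compactly supported functions only. No mass escapes to infinity as
  \<open>t\<close> varies because every \<open>U t\<close> has total mass \<open>1\<close>: the mass near infinity is \<open>1\<close> minus
  the integral of a wide bump, which depends continuously on \<open>t\<close>.
\<close>

lemma fundamental_solution_continuous_smooth:
  assumes U: "fundamental_solution \<alpha> U" and \<phi>: "smooth \<phi>" and bnd: "\<And>x. \<bar>\<phi> x\<bar> \<le> 1"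
  shows "continuous_on {0..} (\<lambda>t. LINT s|U t. \<phi> s)"
  unfolding continuous_on_iff
proof (intro ballI allI impI)
  fix t e :: real assume t: "t \<in> {0..}" and e: "0 < e"
  interpret t: real_distribution "U t"
    using fundamental_solution_real_distribution[OF U] t by simp
  have "\<forall>\<^sub>F n in sequentially. 1 - e / 4 < (LINT s|U t. bump (s / real (Suc n)))"
    using order_tendstoD(1)[OF t.integral_bump_tendsto, of "1 - e / 4"] e by simp
  then obtain n where n: "1 - e / 4 < (LINT s|U t. bump (s / real (Suc n)))"
    by (auto simp: eventually_sequentially)
  define R where "R = real (Suc n)"
  have R: "0 < R" by (simp add: R_def)
  define h where "h s = (LINT x|U s. cutoff R \<phi> x)" for s
  define k where "k s = (LINT x|U s. bump (x / R))" for s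
  have "test_function (cutoff R (\<lambda>_. 1))"
    using smooth_trig[of 1 0 0] R by (intro cutoff_test_function) simp_all
  then have contk: "continuous_on {0..} k"
    using fundamental_solution_test(1)[OF U] by (simp add: k_def[abs_def] cutoff_def[abs_def])
  have conth: "continuous_on {0..} h"
    unfolding h_def[abs_def] by (intro fundamental_solution_test(1)[OF U] cutoff_test_function \<phi> R)
  obtain d1 where d1: "d1 > 0" "\<And>s. s \<in> {0..} \<Longrightarrow> dist s t < d1 \<Longrightarrow> dist (h s) (h t) < e / 4"
    using continuous_on_iff[THEN iffD1, rule_format, OF conth t, of "e / 4"] e by auto
  obtain d2 where d2: "d2 > 0" "\<And>s. s \<in> {0..} \<Longrightarrow> dist s t < d2 \<Longrightarrow> dist (k s) (k t) < e / 4"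
    using continuous_on_iff[THEN iffD1, rule_format, OF contk t, of "e / 4"] e by auto
  have approx: "\<bar>(LINT x|U s. \<phi> x) - h s\<bar> \<le> 1 - k s" if "s \<in> {0..}" for s
  proof -
    interpret s: real_distribution "U s"
      using fundamental_solution_real_distribution[OF U] that by simp
    note [measurable] = smooth_measurable[OF \<phi>] smooth_measurable[OF bump_rescaled_smooth]
    have i1: "integrable (U s) \<phi>"
      by (rule s.integrable_bounded[OF _ bnd]) measurable
    have bb: "\<bar>bump x\<bar> \<le> 1" for x
      using bump_range[of x] by simp
    have i2: "integrable (U s) (\<lambda>x. bump (x / R))"
      by (rule s.integrable_bounded[OF _ bb]) measurable
    have "\<bar>cutoff R \<phi> x\<bar> \<le> 1" for x
      using mult_mono[OF bnd[of x] bb[of "x / R"]] by (simp add: cutoff_def abs_mult)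
    then have i3: "integrable (U s) (cutoff R \<phi>)"
      by (rule s.integrable_bounded[rotated]) (simp add: cutoff_def[abs_def])
    have "(LINT x|U s. \<phi> x) - h s = (LINT x|U s. \<phi> x - cutoff R \<phi> x)"
      unfolding h_def using i1 i3 by simp
    also have "\<bar>\<dots>\<bar> \<le> (LINT x|U s. \<bar>\<phi> x - cutoff R \<phi> x\<bar>)"
      by (rule integral_abs_bound)
    also have "\<dots> \<le> (LINT x|U s. 1 - bump (x / R))"
    proof (rule integral_mono)
      show "integrable (U s) (\<lambda>x. \<bar>\<phi> x - cutoff R \<phi> x\<bar>)" "integrable (U s) (\<lambda>x. 1 - bump (x / R))"
        using i1 i2 i3 by auto
      fix x
      have "\<phi> x - cutoff R \<phi> x = \<phi> x * (1 - bump (x / R))"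
        by (simp add: cutoff_def algebra_simps)
      then have "\<bar>\<phi> x - cutoff R \<phi> x\<bar> = \<bar>\<phi> x\<bar> * (1 - bump (x / R))"
        using bump_range[of "x / R"] by (simp add: abs_mult)
      also have "\<dots> \<le> 1 * (1 - bump (x / R))"
        using bnd[of x] bump_range[of "x / R"] by (intro mult_right_mono) auto
      finally show "\<bar>\<phi> x - cutoff R \<phi> x\<bar> \<le> 1 - bump (x / R)"
        by simp
    qed
    also have "\<dots> = 1 - k s"
      using i2 s.prob_space by (simp add: k_def)
    finally show ?thesis .
  qed
  show "\<exists>d>0. \<forall>s\<in>{0..}. dist s t < d \<longrightarrow> dist (LINT x|U s. \<phi> x) (LINT x|U t. \<phi> x) < e"
  proof (intro exI[of _ "min d1 d2"] conjI ballI impI)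
    fix s :: real assume s: "s \<in> {0..}" "dist s t < min d1 d2"
    have "1 - e / 4 < k t"
      using n by (simp add: k_def R_def)
    moreover have "\<bar>h s - h t\<bar> < e / 4" "\<bar>k s - k t\<bar> < e / 4"
      using d1(2)[of s] d2(2)[of s] s by (auto simp: dist_real_def)
    ultimately show "dist (LINT x|U s. \<phi> x) (LINT x|U t. \<phi> x) < e"
      using approx[OF s(1)] approx[OF t] unfolding dist_real_def abs_less_iff abs_le_iff by linarith
  qed (use d1 d2 in auto)
qed

lemma (in real_distribution) char_eq_cos_sin:
  "char M \<xi> = Complex (LINT x|M. cos (\<xi> * x)) (LINT x|M. sin (\<xi> * x))"
proof (rule complex_eqI)
  have "integrable M (\<lambda>x. iexp (\<xi> * x))"
    by (rule integrable_iexp) auto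
  moreover have "iexp (\<xi> * x) = cis (\<xi> * x)" for x
    by (simp add: cis_conv_exp)
  ultimately have int: "integrable M (\<lambda>x. cis (\<xi> * x))" and char: "char M \<xi> = (CLINT x|M. cis (\<xi> * x))"
    by (simp_all only: char_def)
  show "Re (char M \<xi>) = Re (Complex (LINT x|M. cos (\<xi> * x)) (LINT x|M. sin (\<xi> * x)))"
    using integral_bounded_linear[OF bounded_linear_Re int] by (simp add: char)
  show "Im (char M \<xi>) = Im (Complex (LINT x|M. cos (\<xi> * x)) (LINT x|M. sin (\<xi> * x)))"
    using integral_bounded_linear[OF bounded_linear_Im int] by (simp add: char)
qed

lemma smooth_cos_sin: "smooth (\<lambda>x. cos (\<xi> * x))" "smooth (\<lambda>x. sin (\<xi> * x))"
  using smooth_trig[of 1 \<xi> 0] smooth_trig[of 0 \<xi> 1] by simp_all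

text \<open>
  Sines and cosines are bounded and smooth, so the characteristic functions of \<open>U t\<close> are continuous
  in \<open>t\<close>, and Levy's continuity theorem extends this to all bounded continuous functions.
\<close>

lemma fundamental_solution_weakly_continuous:
  fixes \<psi> :: "real \<Rightarrow> real"
  assumes U: "fundamental_solution \<alpha> U" and \<psi>: "\<And>x. isCont \<psi> x" "\<And>x. \<bar>\<psi> x\<bar> \<le> B"
  shows "continuous_on {0..} (\<lambda>t. LINT s|U t. \<psi> s)"
proof (rule continuous_on_sequentiallyI)
  fix u :: "nat \<Rightarrow> real" and a assume u: "\<forall>n. u n \<in> {0..}" "a \<in> {0..}" "u \<longlonglongrightarrow> a"
  have D: "real_distribution (U (u n))" "real_distribution (U a)" for n
    using u by (auto intro!: fundamental_solution_real_distribution[OF U])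
  have conv: "(\<lambda>n. LINT s|U (u n). \<phi> s) \<longlonglongrightarrow> (LINT s|U a. \<phi> s)"
    if "smooth \<phi>" "\<And>x. \<bar>\<phi> x\<bar> \<le> 1" for \<phi>
    using continuous_on_tendsto_compose[OF fundamental_solution_continuous_smooth[OF U that] u(3,2)] u(1)
    by simp
  have "weak_conv_m (\<lambda>n. U (u n)) (U a)"
  proof (rule levy_continuity)
    show "(\<lambda>n. char (U (u n)) \<xi>) \<longlonglongrightarrow> char (U a) \<xi>" for \<xi>
      unfolding real_distribution.char_eq_cos_sin[OF D(1)] real_distribution.char_eq_cos_sin[OF D(2)]
      by (intro tendsto_Complex conv smooth_cos_sin) auto
  qed (use D in auto)
  then show "(\<lambda>n. LINT s|U (u n). \<psi> s) \<longlonglongrightarrow> (LINT s|U a. \<psi> s)"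
    using \<psi> by (intro weak_conv_imp_integral_bdd_continuous_conv[where B = B] D) auto
qed

lemma cts_step_props:
  assumes "a < b"
  shows "isCont (cts_step a b) x" "\<bar>cts_step a b x\<bar> \<le> 1" "cts_step a b \<in> borel_measurable borel"
proof -
  have "continuous_on UNIV (cts_step a b)"
    by (rule uniformly_continuous_imp_continuous[OF cts_step_uniformly_continuous[OF assms]])
  then show "isCont (cts_step a b) x" "cts_step a b \<in> borel_measurable borel"
    by (auto simp: continuous_on_eq_continuous_at intro: borel_measurable_continuous_onI)
  show "\<bar>cts_step a b x\<bar> \<le> 1"
    using assms by (auto simp: cts_step_def)
qed

text \<open>
  The distribution function of \<open>U t\<close> at a point is a limit of integrals of continuous steps, each
  continuous in \<open>t\<close>. The kernel on the whole line is obtained by sending negative times to \<open>U 0\<close>.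
\<close>

lemma fundamental_solution_kernel:
  assumes U: "fundamental_solution \<alpha> U"
  shows "(\<lambda>t. U (max 0 t)) \<in> measurable borel (prob_algebra borel)"
proof (rule measurable_prob_algebra_generated)
  show "sets borel = sigma_sets UNIV (range (\<lambda>x::real. {..x}))"
    by (subst borel_eq_atMost) simp
  show "Int_stable (range (\<lambda>x::real. {..x}))"
    by (auto simp: Int_stable_def)
  have D: "real_distribution (U (max 0 t))" for t
    by (rule fundamental_solution_real_distribution[OF U]) simp
  then show "prob_space (U (max 0 t))" "sets (U (max 0 t)) = sets borel" for t
    by (auto simp: real_distribution_def real_distribution_axioms_def)
  fix A :: "real set" assume "A \<in> range (\<lambda>x. {..x})"
  then obtain x where A: "A = {..x}" by auto
  define b where "b n = x + 1 / real (Suc n)" for n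
  have b: "x < b n" for n by (simp add: b_def)
  define F where "F n t = (LINT s|U (max 0 t). cts_step x (b n) s)" for n t
  have "F n \<in> borel_measurable borel" for n
  proof -
    have "continuous_on UNIV (F n)"
      unfolding F_def
      by (rule continuous_on_compose2[OF fundamental_solution_weakly_continuous[OF U]])
        (auto intro!: continuous_intros cts_step_props[OF b])
    then show ?thesis
      by (rule borel_measurable_continuous_onI)
  qed
  moreover have "(\<lambda>n. F n t) \<longlonglongrightarrow> measure (U (max 0 t)) A" for t
  proof -
    interpret real_distribution "U (max 0 t)" by (rule D)
    have "(\<lambda>n. F n t) \<longlonglongrightarrow> (LINT s|U (max 0 t). indicator {..x} s)"
      unfolding F_def
    proof (rule integral_dominated_convergence[where w = "\<lambda>_. 1"])
      show "AE s in U (max 0 t). (\<lambda>n. cts_step x (b n) s) \<longlonglongrightarrow> indicator {..x} s"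
      proof (rule AE_I2, cases)
        fix s assume "s \<le> x"
        then show "(\<lambda>n. cts_step x (b n) s) \<longlonglongrightarrow> indicator {..x} s"
          by (simp add: cts_step_def)
      next
        fix s assume s: "\<not> s \<le> x"
        have "b \<longlonglongrightarrow> x"
          unfolding b_def[abs_def] using LIMSEQ_inverse_real_of_nat_add[of x] by (simp add: divide_inverse)
        then have "\<forall>\<^sub>F n in sequentially. b n < s"
          using s by (intro order_tendstoD(2)) auto
        then have "\<forall>\<^sub>F n in sequentially. cts_step x (b n) s = indicator {..x} s"
          by eventually_elim (use s in \<open>auto simp: cts_step_def\<close>)
        then show "(\<lambda>n. cts_step x (b n) s) \<longlonglongrightarrow> indicator {..x} s"
          by (rule tendsto_eventually)
      qed
    qed (use cts_step_props[OF b] in auto)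
    then show ?thesis
      by (simp add: A)
  qed
  ultimately have "(\<lambda>t. measure (U (max 0 t)) A) \<in> borel_measurable borel"
    by (rule borel_measurable_LIMSEQ_real[rotated])
  moreover have "emeasure (U (max 0 t)) A = ennreal (measure (U (max 0 t)) A)" for t
    using D[of t] by (simp add: real_distribution_def prob_space_def finite_measure.emeasure_eq_measure)
  ultimately show "(\<lambda>t. emeasure (U (max 0 t)) A) \<in> borel_measurable borel"
    by simp
qed auto

section \<open>The fundamental solution at an exponential time\<close>

definition laplace_distribution :: "real \<Rightarrow> real measure" where
  "laplace_distribution c = density lborel (\<lambda>y. ennreal (c / 2 * exp (- c * \<bar>y\<bar>)))"

lemma two_sided_exponential_integral:
  fixes \<psi> :: "real \<Rightarrow> real"
  assumes c: "0 < c" and [measurable]: "\<psi> \<in> borel_measurable borel" and bnd: "\<And>x. \<bar>\<psi> x\<bar> \<le> B"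
  shows "has_bochner_integral lborel (\<lambda>y. c / 2 * exp (- c * \<bar>y\<bar>) * \<psi> y)
    (c / 2 * (laplace c \<psi> + laplace c (\<lambda>y. \<psi> (- y))))"
proof -
  have half: "has_bochner_integral lborel (\<lambda>y. indicator {0<..} y * (exp (- c * y) * \<phi> y)) (laplace c \<phi>)"
    if [measurable]: "\<phi> \<in> borel_measurable borel" and "\<And>x. \<bar>\<phi> x\<bar> \<le> B" for \<phi>
    using laplace_integrable_bounded[OF c, of \<phi> B] that
    by (auto simp: has_bochner_integral_iff laplace_def set_integrable_def set_lebesgue_integral_def
        set_borel_measurable_def)
  have "has_bochner_integral lborel (\<lambda>y. indicator {0<..} (- y) * (exp (- c * (- y)) * \<psi> (- (- y))))
      (laplace c (\<lambda>y. \<psi> (- y)))"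
    using lborel_has_bochner_integral_real_affine_iff[of "-1"
        "\<lambda>y. indicator {0<..} y * (exp (- c * y) * \<psi> (- y))" "laplace c (\<lambda>y. \<psi> (- y))" 0]
      half[of "\<lambda>y. \<psi> (- y)"] bnd by simp
  from has_bochner_integral_add[OF half[OF _ bnd] this]
  have "has_bochner_integral lborel (\<lambda>y. c / 2 * (indicator {0<..} y * (exp (- c * y) * \<psi> y) +
      indicator {0<..} (- y) * (exp (- c * (- y)) * \<psi> (- (- y)))))
      (c / 2 * (laplace c \<psi> + laplace c (\<lambda>y. \<psi> (- y))))"
    by (intro has_bochner_integral_mult_right) simp
  \<comment> \<open>The origin lies in neither of the two open half-lines.\<close>
  then show ?thesis
    by (rule has_bochner_integral_discrete_difference[where X = "{0}", THEN iffD1, rotated 4])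
      (auto simp: indicator_def)
qed

lemma real_distribution_laplace_distribution:
  assumes "0 < c"
  shows "real_distribution (laplace_distribution c)"
proof -
  have "has_bochner_integral lborel (\<lambda>y. c / 2 * exp (- c * \<bar>y\<bar>)) 1"
    using two_sided_exponential_integral[OF assms, of "\<lambda>_. 1" 1] laplace_const(2)[OF assms, of 1] assms
    by simp
  then have "(\<integral>\<^sup>+y. ennreal (c / 2 * exp (- c * \<bar>y\<bar>)) \<partial>lborel) = 1"
    using assms nn_integral_eq_integral[of lborel "\<lambda>y. c / 2 * exp (- c * \<bar>y\<bar>)"]
    by (simp add: has_bochner_integral_iff)
  then have "prob_space (laplace_distribution c)"
    unfolding laplace_distribution_def by (intro prob_spaceI) (simp add: emeasure_density)
  then show ?thesis
    by (simp add: real_distribution_def real_distribution_axioms_def laplace_distribution_def)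
qed

lemma integral_laplace_distribution:
  fixes \<psi> :: "real \<Rightarrow> real"
  assumes c: "0 < c" and [measurable]: "\<psi> \<in> borel_measurable borel" and bnd: "\<And>x. \<bar>\<psi> x\<bar> \<le> B"
  shows "(LINT y|laplace_distribution c. \<psi> y) = c / 2 * (laplace c \<psi> + laplace c (\<lambda>y. \<psi> (- y)))"
  using two_sided_exponential_integral[OF assms] c unfolding laplace_distribution_def
  by (subst integral_density) (auto simp: has_bochner_integral_iff)

lemma deriv2_cos_sin:
  fixes \<xi> :: real
  shows "deriv (\<lambda>x. cos (\<xi> * x)) = (\<lambda>x. - (\<xi> * sin (\<xi> * x)))"
    and "deriv (\<lambda>x. - (\<xi> * sin (\<xi> * x))) = (\<lambda>x. - (\<xi>\<^sup>2 * cos (\<xi> * x)))"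
    and "deriv (\<lambda>x. sin (\<xi> * x)) = (\<lambda>x. \<xi> * cos (\<xi> * x))"
    and "deriv (\<lambda>x. \<xi> * cos (\<xi> * x)) = (\<lambda>x. - (\<xi>\<^sup>2 * sin (\<xi> * x)))"
  by (intro ext DERIV_imp_deriv; auto intro!: derivative_eq_intros simp: power2_eq_square)+

text \<open>The cosine solves \<open>f'' = - \<xi>\<^sup>2 f\<close>, which is a Caputo equation of order \<open>2\<close>.\<close>

lemma laplace_cos:
  assumes c: "0 < c"
  shows "laplace c (\<lambda>x. cos (\<xi> * x)) = c / (c\<^sup>2 + \<xi>\<^sup>2)"
proof -
  let ?f = "\<lambda>x::real. cos (\<xi> * x)"
  have n: "nat \<lceil>2::real\<rceil> = 2" by simp
  note s = smooth_cos_sin(1)[of \<xi>]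
  have m: "set_borel_measurable borel {0<..} (\<lambda>x. - (\<xi>\<^sup>2 * cos (\<xi> * x)))"
    unfolding set_borel_measurable_def by measurable
  have "caputo_differentiable 2 ?f"
    unfolding caputo_differentiable_def Let_def n
  proof (intro conjI allI impI)
    show "(deriv ^^ i) ?f field_differentiable (at t)" for i t
      using s unfolding smooth_def by blast
    show "set_integrable lborel {0<..<t} ((deriv ^^ 2) ?f)" for t
    proof -
      have "set_integrable lborel {0..t} ((deriv ^^ 2) ?f)"
        unfolding numeral_2_eq_2 funpow.simps comp_def id_def deriv2_cos_sin
        by (intro borel_integrable_atLeastAtMost' continuous_intros)
      then show ?thesis
        by (rule set_integrable_subset) auto
    qed
  qed (auto intro!: continuous_intros)
  moreover have "caputo 2 ?f t = - (\<xi>\<^sup>2 * cos (\<xi> * t))" for t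
    unfolding caputo_def Let_def n by (simp add: numeral_2_eq_2 deriv2_cos_sin)
  moreover have "(?f has_real_derivative 0) (at 0 within {0..})"
    by (auto intro!: derivative_eq_intros)
  ultimately have lap: "laplace c ?f = ?f 0 / c + c powr (- 2) * laplace c (\<lambda>x. - (\<xi>\<^sup>2 * cos (\<xi> * x)))"
    using c by (intro caputo_laplace[where C = "\<xi>\<^sup>2"] m) (auto simp: abs_mult mult_left_le)
  have "laplace c (\<lambda>x. - (\<xi>\<^sup>2 * cos (\<xi> * x))) = - \<xi>\<^sup>2 * laplace c ?f"
    using laplace_cmult[of c "- \<xi>\<^sup>2" ?f] by simp
  with lap have "laplace c ?f = 1 / c + c powr (- 2) * (- \<xi>\<^sup>2 * laplace c ?f)"
    by (simp only:) simp
  then have "laplace c ?f = 1 / c - \<xi>\<^sup>2 / c\<^sup>2 * laplace c ?f"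
    using c by (simp add: powr_minus_divide powr_numeral)
  then have "c * (laplace c ?f * (c\<^sup>2 + \<xi>\<^sup>2)) = c * c"
    using c by (simp add: field_simps power2_eq_square)
  then have "laplace c ?f * (c\<^sup>2 + \<xi>\<^sup>2) = c"
    using c mult_left_cancel[of c] by (metis less_irrefl)
  moreover have "c\<^sup>2 + \<xi>\<^sup>2 \<noteq> 0"
    using c by (simp add: sum_power2_eq_zero_iff)
  ultimately show ?thesis
    by (simp add: eq_divide_eq)
qed

lemma char_laplace_distribution:
  assumes c: "0 < c"
  shows "char (laplace_distribution c) \<xi> = Complex (1 / (1 + \<xi>\<^sup>2 / c\<^sup>2)) 0"
proof -
  have "(LINT y|laplace_distribution c. cos (\<xi> * y)) = c * (c / (c\<^sup>2 + \<xi>\<^sup>2))"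
    using laplace_cos[OF c, of \<xi>] integral_laplace_distribution[OF c, of "\<lambda>y. cos (\<xi> * y)" 1] by simp
  also have "\<dots> = 1 / (1 + \<xi>\<^sup>2 / c\<^sup>2)"
    using c by (simp add: field_simps power2_eq_square)
  finally have 1: "(LINT y|laplace_distribution c. cos (\<xi> * y)) = 1 / (1 + \<xi>\<^sup>2 / c\<^sup>2)" .
  have "laplace c (\<lambda>y. - sin (\<xi> * y)) = - laplace c (\<lambda>y. sin (\<xi> * y))"
    using laplace_cmult[of c "-1" "\<lambda>y. sin (\<xi> * y)"] by simp
  then have "(LINT y|laplace_distribution c. sin (\<xi> * y)) = 0"
    using integral_laplace_distribution[OF c, of "\<lambda>y. sin (\<xi> * y)" 1] by simp
  with 1 show ?thesis
    by (simp add: real_distribution.char_eq_cos_sin[OF real_distribution_laplace_distribution[OF c]])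
qed

text \<open>
  The hypothesis is the equation \<open>M - k M'' = \<delta>\<close> in the sense of distributions. As \<open>M\<close> is
  finite, it extends from compactly supported functions to \<open>\<phi>\<close> with bounded derivatives: in the second
  derivative of a wide cutoff of \<open>\<phi>\<close>, the terms in which the bump is differentiated are small.
\<close>

lemma (in real_distribution) resolvent_identity_smooth:
  assumes test: "\<And>\<phi>. test_function \<phi> \<Longrightarrow> (LINT s|M. \<phi> s) = \<phi> 0 + k * (LINT s|M. (deriv ^^ 2) \<phi> s)"
    and \<phi>: "smooth \<phi>"
    and B: "\<And>x. \<bar>\<phi> x\<bar> \<le> B" "\<And>x. \<bar>deriv \<phi> x\<bar> \<le> B" "\<And>x. \<bar>deriv (deriv \<phi>) x\<bar> \<le> B"
  shows "(LINT s|M. \<phi> s) = \<phi> 0 + k * (LINT s|M. deriv (deriv \<phi>) s)"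
proof -
  obtain C where C: "\<And>x. \<bar>bump x\<bar> \<le> C" "\<And>x. \<bar>deriv bump x\<bar> \<le> C" "\<And>x. \<bar>deriv (deriv bump) x\<bar> \<le> C"
    using bump_derivs_bounded by blast
  have nonneg: "0 \<le> B" "0 \<le> C"
    using B(1)[of 0] C(1)[of 0] by linarith+
  define R where "R n = real (Suc n)" for n
  have R: "1 \<le> R n" "0 < R n" for n
    by (simp_all add: R_def)
  have Rinv: "(\<lambda>n. 1 / R n) \<longlonglongrightarrow> 0"
    unfolding R_def using LIMSEQ_inverse_real_of_nat by (simp add: divide_inverse)
  define D where "D n s = (deriv ^^ 2) (cutoff (R n) \<phi>) s" for n s
  note s' = smooth_derivs(2)[OF \<phi>] and b' = smooth_derivs(2)[OF bump_smooth]
  note [measurable] = smooth_measurable[OF \<phi>] smooth_measurable[OF s'] smooth_measurable[OF smooth_derivs(2)[OF s']]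
    smooth_measurable[OF bump_smooth] smooth_measurable[OF b'] smooth_measurable[OF smooth_derivs(2)[OF b']]
  have D: "D n s = deriv (deriv \<phi>) s * bump (s / R n)
    + 2 * deriv \<phi> s * deriv bump (s / R n) * (1 / R n) + \<phi> s * deriv (deriv bump) (s / R n) * (1 / R n)\<^sup>2" for n s
    unfolding D_def using cutoff_deriv2[OF \<phi> R(2)] by (simp add: power_divide)
  have sR: "(\<lambda>n. s / R n) \<longlonglongrightarrow> 0" for s
    using tendsto_mult[OF tendsto_const Rinv, of s] by simp
  have conv: "(\<lambda>n. f (s / R n)) \<longlonglongrightarrow> f 0" if "smooth f" for f s
    by (rule isCont_tendsto_compose[OF smooth_isCont[OF that] sR])
  have "(\<lambda>n. LINT s|M. cutoff (R n) \<phi> s) \<longlonglongrightarrow> (LINT s|M. \<phi> s)"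
  proof (rule integral_dominated_convergence[where w = "\<lambda>_. B * C"])
    show "AE s in M. (\<lambda>n. cutoff (R n) \<phi> s) \<longlonglongrightarrow> \<phi> s"
      using tendsto_mult[OF tendsto_const conv[OF bump_smooth]] by (simp add: cutoff_def bump_0)
    show "AE s in M. norm (cutoff (R n) \<phi> s) \<le> B * C" for n
      using nonneg by (auto simp: cutoff_def abs_mult intro!: mult_mono B C)
  qed (simp_all add: cutoff_def[abs_def])
  moreover have "(\<lambda>n. LINT s|M. D n s) \<longlonglongrightarrow> (LINT s|M. deriv (deriv \<phi>) s)"
  proof (rule integral_dominated_convergence[where w = "\<lambda>_. B * C + 2 * B * C * 1 + B * C * 1\<^sup>2"])
    have "(\<lambda>n. D n s) \<longlonglongrightarrow> deriv (deriv \<phi>) s * bump 0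
      + 2 * deriv \<phi> s * deriv bump 0 * 0 + \<phi> s * deriv (deriv bump) 0 * 0\<^sup>2" for s
      unfolding D by (intro tendsto_intros conv Rinv bump_smooth b' smooth_derivs(2)[OF b'])
    then show "AE s in M. (\<lambda>n. D n s) \<longlonglongrightarrow> deriv (deriv \<phi>) s"
      by (simp add: bump_0)
    show "AE s in M. norm (D n s) \<le> B * C + 2 * B * C * 1 + B * C * 1\<^sup>2" for n
    proof (rule AE_I2)
      fix s
      have "\<bar>D n s\<bar> \<le> \<bar>deriv (deriv \<phi>) s * bump (s / R n)\<bar> + \<bar>2 * deriv \<phi> s * deriv bump (s / R n) * (1 / R n)\<bar>
          + \<bar>\<phi> s * deriv (deriv bump) (s / R n) * (1 / R n)\<^sup>2\<bar>"
        unfolding D by linarith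
      also have "\<dots> \<le> B * C + 2 * B * C * 1 + B * C * 1\<^sup>2"
        unfolding abs_mult power_abs using nonneg R[of n]
        by (intro add_mono mult_mono power_mono B C) auto
      finally show "norm (D n s) \<le> B * C + 2 * B * C * 1 + B * C * 1\<^sup>2"
        by simp
    qed
  qed (simp_all add: D)
  then have "(\<lambda>n. \<phi> 0 + k * (LINT s|M. D n s)) \<longlonglongrightarrow> \<phi> 0 + k * (LINT s|M. deriv (deriv \<phi>) s)"
    by (intro tendsto_intros)
  moreover have "(LINT s|M. cutoff (R n) \<phi> s) = \<phi> 0 + k * (LINT s|M. D n s)" for n
    using test[OF cutoff_test_function[OF \<phi> R(2)]] by (simp add: D_def cutoff_def bump_0)
  ultimately show ?thesis
    using LIMSEQ_unique by simp
qed

text \<open>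
  Sines and cosines are eigenfunctions of the second derivative, so that the identity becomes a linear
  equation for each value of the characteristic function.
\<close>

lemma (in real_distribution) resolvent_identity_char:
  assumes test: "\<And>\<phi>. test_function \<phi> \<Longrightarrow> (LINT s|M. \<phi> s) = \<phi> 0 + k * (LINT s|M. (deriv ^^ 2) \<phi> s)"
    and k: "0 < k"
  shows "char M \<xi> = Complex (1 / (1 + \<xi>\<^sup>2 * k)) 0"
proof -
  have bnd: "\<bar>cos x\<bar> \<le> 1 + \<bar>\<xi>\<bar> + \<xi>\<^sup>2" "\<bar>sin x\<bar> \<le> 1 + \<bar>\<xi>\<bar> + \<xi>\<^sup>2"
    "\<bar>\<xi>\<bar> * \<bar>cos x\<bar> \<le> 1 + \<bar>\<xi>\<bar> + \<xi>\<^sup>2" "\<bar>\<xi>\<bar> * \<bar>sin x\<bar> \<le> 1 + \<bar>\<xi>\<bar> + \<xi>\<^sup>2"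
    "\<xi>\<^sup>2 * \<bar>cos x\<bar> \<le> 1 + \<bar>\<xi>\<bar> + \<xi>\<^sup>2" "\<xi>\<^sup>2 * \<bar>sin x\<bar> \<le> 1 + \<bar>\<xi>\<bar> + \<xi>\<^sup>2" for x :: real
    using abs_cos_le_one[of x] abs_sin_le_one[of x]
      mult_left_le[of "\<bar>cos x\<bar>" "\<bar>\<xi>\<bar>"] mult_left_le[of "\<bar>sin x\<bar>" "\<bar>\<xi>\<bar>"]
      mult_left_le[of "\<bar>cos x\<bar>" "\<xi>\<^sup>2"] mult_left_le[of "\<bar>sin x\<bar>" "\<xi>\<^sup>2"]
    by (smt (verit) zero_le_power2 abs_ge_zero)+
  have "(LINT s|M. cos (\<xi> * s)) = 1 + k * (LINT s|M. - (\<xi>\<^sup>2 * cos (\<xi> * s)))"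
    using resolvent_identity_smooth[OF test smooth_cos_sin(1)[of \<xi>], of "1 + \<bar>\<xi>\<bar> + \<xi>\<^sup>2"] bnd
    by (simp add: deriv2_cos_sin abs_mult)
  then have "(LINT s|M. cos (\<xi> * s)) * (1 + \<xi>\<^sup>2 * k) = 1"
    by (simp add: algebra_simps)
  moreover have pos: "0 < 1 + \<xi>\<^sup>2 * k"
    using k by (simp add: add_pos_nonneg)
  ultimately have 1: "(LINT s|M. cos (\<xi> * s)) = 1 / (1 + \<xi>\<^sup>2 * k)"
    by (simp add: field_simps)
  have "(LINT s|M. sin (\<xi> * s)) = k * (LINT s|M. - (\<xi>\<^sup>2 * sin (\<xi> * s)))"
    using resolvent_identity_smooth[OF test smooth_cos_sin(2)[of \<xi>], of "1 + \<bar>\<xi>\<bar> + \<xi>\<^sup>2"] bnd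
    by (simp add: deriv2_cos_sin abs_mult)
  then have "(LINT s|M. sin (\<xi> * s)) * (1 + \<xi>\<^sup>2 * k) = 0"
    by (simp add: algebra_simps)
  then have "(LINT s|M. sin (\<xi> * s)) = 0"
    using pos by simp
  with 1 show ?thesis
    by (simp add: char_eq_cos_sin)
qed

text \<open>
  The left-hand side is the mean of \<open>\<psi>\<close> under \<open>U\<close> at an exponential time of rate \<open>\<mu>\<close>, and the
  right-hand side is its mean under the two-sided exponential law of rate \<open>c\<close>. Both laws satisfy
  the resolvent equation with \<open>k = 1 / c\<^sup>2\<close>, hence have the same characteristic function.
\<close>

lemma fundamental_solution_laplace:
  fixes \<psi> :: "real \<Rightarrow> real"
  assumes U: "fundamental_solution \<alpha> U" and \<alpha>: "0 < \<alpha>" "\<alpha> \<le> 2" and \<mu>: "0 < \<mu>"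
    and \<psi>: "\<psi> \<in> borel_measurable borel" "\<And>x. \<bar>\<psi> x\<bar> \<le> B"
    and c: "c = \<mu> powr (\<alpha> / 2)"
  shows "\<mu> * laplace \<mu> (\<lambda>t. LINT s|U t. \<psi> s) = c / 2 * (laplace c \<psi> + laplace c (\<lambda>y. \<psi> (- y)))"
proof -
  have c0: "0 < c" using \<mu> c by simp
  define E where "E = density lborel (exponential_density \<mu>)"
  define K where "K t = U (max 0 t)" for t
  have K: "K \<in> measurable borel (prob_algebra borel)"
    using fundamental_solution_kernel[OF U] by (simp add: K_def[abs_def])
  interpret E: prob_space E
    unfolding E_def by (rule prob_space_exponential_density[OF \<mu>])
  have [measurable_cong]: "sets E = sets borel"
    by (simp add: E_def)
  have KE: "K \<in> measurable E (prob_algebra borel)"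
    using K by (simp cong: measurable_cong_sets add: \<open>sets E = sets borel\<close>)
  then have KE': "K \<in> measurable E (subprob_algebra borel)"
    by (rule measurable_prob_algebraD)
  define W where "W = E \<bind> K"
  have sets_W: "sets W = sets borel"
    unfolding W_def by (rule sets_bind[of _ _ borel]) (use measurable_space[OF KE'] E.not_empty in \<open>auto simp: space_subprob_algebra\<close>)
  have K_prob: "prob_space (K t)" for t
    using measurable_space[OF K, of t] by (simp add: space_prob_algebra)
  have "prob_space W"
    unfolding W_def by (rule E.prob_space_bind[OF _ KE']) (simp add: K_prob)
  then interpret W: real_distribution W
    by (simp add: real_distribution_def real_distribution_axioms_def sets_W)
  have W_int: "(LINT s|W. \<phi> s) = \<mu> * laplace \<mu> (\<lambda>t. LINT s|U t. \<phi> s)"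
    if [measurable]: "\<phi> \<in> borel_measurable borel" and bnd: "\<And>x. \<bar>\<phi> x\<bar> \<le> C" for \<phi> :: "real \<Rightarrow> real" and C
  proof -
    have [measurable]: "(\<lambda>t. LINT s|K t. \<phi> s) \<in> borel_measurable borel"
      by (rule measurable_compose[OF measurable_prob_algebraD[OF K] integral_measurable_subprob_algebra]) simp
    have "(LINT s|W. \<phi> s) = (LINT t|E. LINT s|K t. \<phi> s)"
      unfolding W_def
      by (rule integral_bind[where K = borel and B = C and B' = 1])
        (auto simp: E.finite_measure_axioms prob_space.emeasure_space_1 K_prob bnd KE')
    also have "\<dots> = (LINT t|lborel. exponential_density \<mu> t * (LINT s|K t. \<phi> s))"
      unfolding E_def using \<mu>
      by (subst integral_density) (auto simp: exponential_density_def)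
    also have "\<dots> = (LINT t|lborel. \<mu> * (indicator {0<..} t * (exp (- \<mu> * t) * (LINT s|U t. \<phi> s))))"
    proof (rule integral_discrete_difference[of "{0}"])
      fix t :: real
      assume "t \<notin> {0}"
      then show "exponential_density \<mu> t * (LINT s|K t. \<phi> s) =
          \<mu> * (indicator {0<..} t * (exp (- \<mu> * t) * (LINT s|U t. \<phi> s)))"
        by (auto simp: exponential_density_def K_def mult_ac)
    qed auto
    also have "\<dots> = \<mu> * laplace \<mu> (\<lambda>t. LINT s|U t. \<phi> s)"
      by (simp add: laplace_def set_lebesgue_integral_def)
    finally show ?thesis .
  qed
  have "(LINT s|W. \<phi> s) = \<phi> 0 + 1 / c\<^sup>2 * (LINT s|W. (deriv ^^ 2) \<phi> s)" if \<phi>: "test_function \<phi>" for \<phi>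
  proof -
    have \<phi>'': "test_function ((deriv ^^ 2) \<phi>)"
      using \<phi> by (simp add: numeral_2_eq_2 test_function_deriv)
    obtain B1 where B1: "\<And>x. \<bar>\<phi> x\<bar> \<le> B1"
      using test_function_bounded[OF \<phi>] by blast
    obtain B2 where B2: "\<And>x. \<bar>(deriv ^^ 2) \<phi> x\<bar> \<le> B2"
      using test_function_bounded[OF \<phi>''] by blast
    have "\<mu> powr (- \<alpha>) = 1 / c\<^sup>2"
      using \<mu> by (simp add: c powr_minus_divide powr_power)
    then have "\<mu> * laplace \<mu> (\<lambda>t. LINT s|U t. \<phi> s) =
        \<phi> 0 + 1 / c\<^sup>2 * (\<mu> * laplace \<mu> (\<lambda>t. LINT s|U t. (deriv ^^ 2) \<phi> s))"
      using fundamental_solution_test(2)[OF U \<phi> \<alpha> \<mu>] \<mu> by (simp add: field_simps)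
    then show ?thesis
      by (simp only: W_int[OF test_function_measurable[OF \<phi>] B1] W_int[OF test_function_measurable[OF \<phi>''] B2])
  qed
  from W.resolvent_identity_char[OF this] have "char W = char (laplace_distribution c)"
    using c0 by (auto simp: char_laplace_distribution)
  then have "W = laplace_distribution c"
    by (rule Levy_uniqueness[OF W.real_distribution_axioms real_distribution_laplace_distribution[OF c0]])
  then show ?thesis
    using W_int[OF \<psi>] integral_laplace_distribution[OF c0 \<psi>] by simp
qed

section \<open>Subordination of the state probabilities\<close>

lemma set_borel_measurable_halfline:
  fixes f :: "real \<Rightarrow> real"
  assumes "continuous_on {0..} f"
  shows "set_borel_measurable borel {0<..} f"
  unfolding set_borel_measurable_def
  by (rule borel_measurable_continuous_on_indicator) (auto intro: continuous_on_subset[OF assms])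

lemma birth_system_continuous:
  assumes "solves_birth_system \<nu> r p" "1 \<le> k"
  shows "continuous_on {0..} (p k)"
  using assms unfolding solves_birth_system_def caputo_differentiable_def Let_def by simp

lemma birth_system_laplace:
  assumes \<nu>: "0 < \<nu>" "\<nu> \<le> 1" and \<mu>: "0 < \<mu>" and k: "1 \<le> k"
    and p: "solves_birth_system \<nu> r p" and bnd: "\<And>k t. 0 \<le> t \<Longrightarrow> \<bar>p k t\<bar> \<le> 1"
  shows "(\<mu> powr \<nu> + r k) * laplace \<mu> (p k) =
    (if k = 1 then \<mu> powr \<nu> / \<mu> else r (k - 1) * laplace \<mu> (p (k - 1)))"
proof -
  define j where "j = (if k = 1 then 1 else k - 1)"
  define b where "b = (if k = 1 then 0 else r (k - 1))"
  have j: "1 \<le> j" using k by (auto simp: j_def)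
  define g where "g t = - r k * p k t + b * p j t" for t
  note pk = p[unfolded solves_birth_system_def, THEN spec, THEN mp, OF k]
  note cont = birth_system_continuous[OF p k] birth_system_continuous[OF p j]
  have int: "set_integrable lborel {0<..} (\<lambda>t. exp (- \<mu> * t) * (a * p i t))" if "1 \<le> i" for a i
    using laplace_integrable_bounded[OF \<mu> set_borel_measurable_halfline[OF birth_system_continuous[OF p that]], of 1]
      bnd by (simp add: mult.left_commute[of _ a])
  have "laplace \<mu> (p k) = p k 0 / \<mu> + \<mu> powr (- \<nu>) * laplace \<mu> g"
  proof (rule caputo_laplace[OF \<nu>(1) _ \<mu>])
    show "caputo \<nu> (p k) t = g t" if "0 < t" for t
    proof -
      have "\<forall>t>0. caputo \<nu> (p k) t = - r k * p k t + (if k = 1 then 0 else r (k - 1) * p (k - 1) t)"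
        using pk by (elim conjE)
      with that show ?thesis
        by (simp add: g_def b_def j_def)
    qed
    show "caputo_differentiable \<nu> (p k)"
      using pk by (elim conjE)
    show "set_borel_measurable borel {0<..} g"
      unfolding g_def[abs_def] by (intro set_borel_measurable_halfline continuous_intros cont)
    show "\<bar>g t\<bar> \<le> \<bar>r k\<bar> + \<bar>b\<bar>" if "0 < t" for t
    proof -
      have "\<bar>g t\<bar> \<le> \<bar>r k\<bar> * \<bar>p k t\<bar> + \<bar>b\<bar> * \<bar>p j t\<bar>"
        unfolding g_def using abs_triangle_ineq[of "- r k * p k t" "b * p j t"] by (simp add: abs_mult)
      also have "\<dots> \<le> \<bar>r k\<bar> * 1 + \<bar>b\<bar> * 1"
        using bnd[of t] that by (intro add_mono mult_left_mono) auto
      finally show ?thesis by simp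
    qed
  qed (use \<nu> in auto)
  also have "laplace \<mu> g = - r k * laplace \<mu> (p k) + b * laplace \<mu> (p j)"
    unfolding g_def[abs_def] using laplace_add[OF int[OF k, of "- r k"] int[OF j, of b]]
    by (simp only: laplace_cmult)
  finally have "\<mu> powr \<nu> * laplace \<mu> (p k) =
      \<mu> powr \<nu> * (p k 0 / \<mu> + \<mu> powr (- \<nu>) * (- r k * laplace \<mu> (p k) + b * laplace \<mu> (p j)))"
    by (rule arg_cong)
  also have "\<dots> = \<mu> powr \<nu> * (p k 0 / \<mu>) + (- r k * laplace \<mu> (p k) + b * laplace \<mu> (p j))"
    using \<mu> by (simp add: distrib_left powr_minus flip: mult.assoc)
  finally have "(\<mu> powr \<nu> + r k) * laplace \<mu> (p k) = \<mu> powr \<nu> * (p k 0 / \<mu>) + b * laplace \<mu> (p j)"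
    by (simp add: distrib_right)
  moreover have "p k 0 = (if k = 1 then 1 else 0)"
    using pk by (elim conjE)
  ultimately show ?thesis
    by (simp add: b_def j_def split: if_splits)
qed

text \<open>
  With \<open>c = \<mu> powr \<nu>\<close>, both sides are obtained from their predecessors in \<open>k\<close> by multiplication
  with the same factor \<open>r (k - 1) / (c + r k)\<close>.
\<close>

lemma birth_system_laplace_subordination:
  assumes \<nu>: "0 < \<nu>" "\<nu> \<le> 1" and r: "\<forall>k\<ge>1. r k > 0" and \<mu>: "0 < \<mu>" and "1 \<le> k"
    and p: "solves_birth_system \<nu> r p" "\<And>k t. 0 \<le> t \<Longrightarrow> \<bar>p k t\<bar> \<le> 1"
    and q: "solves_birth_system 1 r q" "\<And>k t. 0 \<le> t \<Longrightarrow> \<bar>q k t\<bar> \<le> 1"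
  shows "laplace \<mu> (p k) = \<mu> powr \<nu> / \<mu> * laplace (\<mu> powr \<nu>) (q k)"
  using \<open>1 \<le> k\<close>
proof (induction k rule: dec_induct)
  case base
  define c where "c = \<mu> powr \<nu>"
  have c: "0 < c" using \<mu> by (simp add: c_def)
  have pos: "0 < c + r 1"
    using r c by (simp add: add_pos_pos)
  have 1: "(c + r 1) * laplace \<mu> (p 1) = c / \<mu>"
    using birth_system_laplace[OF \<nu> \<mu> _ p, of 1] by (simp add: c_def)
  have 2: "(c + r 1) * laplace c (q 1) = 1"
    using birth_system_laplace[of 1 c 1, OF _ _ _ _ q] c by simp
  have "(c + r 1) * laplace \<mu> (p 1) = (c + r 1) * (c / \<mu> * laplace c (q 1))"
    using 1 2 by (simp only: mult.left_commute[of "c + r 1" "c / \<mu>"] mult_1_right)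
  then show ?case
    unfolding c_def[symmetric] by (rule mult_left_cancel[THEN iffD1, rotated]) (use pos in simp)
next
  case (step n)
  define c where "c = \<mu> powr \<nu>"
  have c: "0 < c" using \<mu> by (simp add: c_def)
  have pos: "0 < c + r (Suc n)"
    using r c by (simp add: add_pos_pos)
  have 1: "(c + r (Suc n)) * laplace \<mu> (p (Suc n)) = r n * laplace \<mu> (p n)"
    using birth_system_laplace[OF \<nu> \<mu> _ p, of "Suc n"] step by (simp add: c_def)
  have 2: "(c + r (Suc n)) * laplace c (q (Suc n)) = r n * laplace c (q n)"
    using birth_system_laplace[of 1 c "Suc n", OF _ _ _ _ q] step c by simp
  have "(c + r (Suc n)) * laplace \<mu> (p (Suc n)) = (c + r (Suc n)) * (c / \<mu> * laplace c (q (Suc n)))"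
    using 1 2 step.IH unfolding c_def[symmetric]
    by (simp only: mult.left_commute[of "c + r (Suc n)" "c / \<mu>"] mult.left_commute[of "r n" "c / \<mu>"])
  then show ?case
    unfolding c_def[symmetric] by (rule mult_left_cancel[THEN iffD1, rotated]) (use pos in simp)
qed

text \<open>
  The law of the random time is carried by the open half-line, whose indicator is not continuous, so
  weak continuity cannot be applied to \<open>q k\<close> cut off at \<open>0\<close>. It can be applied to
  \<open>q k - q k 0\<close> continued by \<open>0\<close> to the negative half-line. The constant \<open>q k 0\<close> that is split off
  contributes itself, as the random time has total mass \<open>1\<close>.
\<close>

lemma birth_system_subordination:
  assumes \<nu>: "0 < \<nu>" "\<nu> \<le> 1" and r: "\<forall>k\<ge>1. r k > 0" and U: "fundamental_solution (2 * \<nu>) U"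
    and k: "1 \<le> k" and t: "0 \<le> t"
    and p: "solves_birth_system \<nu> r p" "\<And>k t. 0 \<le> t \<Longrightarrow> \<bar>p k t\<bar> \<le> 1"
    and q: "solves_birth_system 1 r q" "\<And>k t. 0 \<le> t \<Longrightarrow> \<bar>q k t\<bar> \<le> 1"
  shows "p k t = q k 0 + 2 * (LINT s|U t. q k (max 0 s) - q k 0)"
proof -
  define \<psi> where "\<psi> s = q k (max 0 s) - q k 0" for s
  have contq: "continuous_on {0..} (q k)" and contp: "continuous_on {0..} (p k)"
    using birth_system_continuous q(1) p(1) k by auto
  have cont\<psi>: "continuous_on UNIV \<psi>"
    unfolding \<psi>_def by (intro continuous_intros continuous_on_compose2[OF contq]) auto
  then have m\<psi>: "\<psi> \<in> borel_measurable borel" and is\<psi>: "isCont \<psi> x" for x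
    by (auto intro: borel_measurable_continuous_onI simp: continuous_on_eq_continuous_at)
  have bnd\<psi>: "\<bar>\<psi> s\<bar> \<le> 2" for s
    using q(2)[of "max 0 s" k] q(2)[of 0 k] by (simp add: \<psi>_def abs_le_iff)
  define h where "h t = (LINT s|U t. \<psi> s)" for t
  have conth: "continuous_on {0..} h"
    unfolding h_def by (rule fundamental_solution_weakly_continuous[OF U is\<psi> bnd\<psi>])
  have bndh: "\<bar>h t\<bar> \<le> 2" if "0 \<le> t" for t
    unfolding h_def
    by (rule real_distribution.integral_abs_le[OF fundamental_solution_real_distribution[OF U that] m\<psi> bnd\<psi>])
  have "p k t - (q k 0 + 2 * h t) = 0"
  proof (rule laplace_eq_0_imp_eq_0[of "\<lambda>t. p k t - (q k 0 + 2 * h t)" 6])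
    show "continuous_on {0..} (\<lambda>t. p k t - (q k 0 + 2 * h t))"
      by (intro continuous_intros contp conth)
    show "\<bar>p k t - (q k 0 + 2 * h t)\<bar> \<le> 6" if "0 \<le> t" for t
      using p(2)[OF that, of k] q(2)[of 0 k] bndh[OF that] by (simp add: abs_le_iff)
    fix \<mu> :: real assume \<mu>: "0 < \<mu>"
    define c where "c = \<mu> powr \<nu>"
    have c: "0 < c" using \<mu> by (simp add: c_def)
    have int: "set_integrable lborel {0<..} (\<lambda>t. exp (- a * t) * (b * f t))"
      if "0 < a" "continuous_on {0..} f" "\<And>t. 0 \<le> t \<Longrightarrow> \<bar>f t\<bar> \<le> 2" for a b :: real and f
      using laplace_integrable_bounded[OF that(1) set_borel_measurable_halfline[OF that(2)], of 2] that(3)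
      by (simp add: mult.left_commute[of _ b])
    have bnd2: "\<bar>p k t\<bar> \<le> 2" "\<bar>q k t\<bar> \<le> 2" if "0 \<le> t" for t
      using p(2)[OF that, of k] q(2)[OF that, of k] by linarith+
    note i1 = laplace_const(1)[OF \<mu>, of "q k 0"] and i2 = int[OF \<mu> conth bndh, of 2]
    have "laplace c \<psi> = laplace c (\<lambda>t. q k t + - q k 0)"
      by (rule laplace_cong) (simp add: \<psi>_def)
    also have "\<dots> = laplace c (q k) - q k 0 / c"
      using laplace_add[OF _ laplace_const(1)[OF c, of "- q k 0"], of "q k"]
        int[OF c contq bnd2(2), of 1] laplace_const(2)[OF c, of "- q k 0"] by simp
    finally have 1: "laplace c \<psi> = laplace c (q k) - q k 0 / c" .
    have 2: "laplace c (\<lambda>y. \<psi> (- y)) = 0"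
      using laplace_cong[of "\<lambda>y. \<psi> (- y)" "\<lambda>_. 0" c] laplace_const(2)[OF c, of 0] by (simp add: \<psi>_def)
    have "\<mu> * laplace \<mu> h = c / 2 * (laplace c \<psi> + laplace c (\<lambda>y. \<psi> (- y)))"
      unfolding h_def[abs_def]
      by (rule fundamental_solution_laplace[OF U _ _ \<mu> m\<psi> bnd\<psi>]) (use \<nu> in \<open>auto simp: c_def\<close>)
    then have "2 * (\<mu> * laplace \<mu> h) = c * laplace c (q k) - q k 0"
      using c unfolding 1 2 by (simp add: right_diff_distrib)
    then have "2 * laplace \<mu> h = c / \<mu> * laplace c (q k) - q k 0 / \<mu>"
      using \<mu> by (simp add: field_simps)
    then have 3: "laplace \<mu> (\<lambda>t. q k 0 + 2 * h t) = c / \<mu> * laplace c (q k)"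
      using laplace_add[OF i1 i2] laplace_const(2)[OF \<mu>, of "q k 0"] by (simp add: laplace_cmult)
    have "set_integrable lborel {0<..} (\<lambda>t. exp (- \<mu> * t) * (q k 0 + 2 * h t))"
      using set_integral_add(1)[OF i1 i2] by (simp add: algebra_simps)
    then have i3: "set_integrable lborel {0<..} (\<lambda>t. exp (- \<mu> * t) * (- 1 * (q k 0 + 2 * h t)))"
      by (subst mult.left_commute) (simp only: set_integrable_mult_right)
    have "laplace \<mu> (\<lambda>t. p k t - (q k 0 + 2 * h t)) = laplace \<mu> (\<lambda>t. p k t + - 1 * (q k 0 + 2 * h t))"
      by (rule laplace_cong) simp
    also have "\<dots> = laplace \<mu> (p k) + - 1 * laplace \<mu> (\<lambda>t. q k 0 + 2 * h t)"
      using laplace_add[OF _ i3, of "p k"] int[OF \<mu> contp bnd2(1), of 1] by (simp only: laplace_cmult mult_1)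
    also have "\<dots> = 0"
      using 3 birth_system_laplace_subordination[OF \<nu> r \<mu> k p q] by (simp add: c_def)
    finally show "laplace \<mu> (\<lambda>t. p k t - (q k 0 + 2 * h t)) = 0" .
  qed fact
  then show ?thesis
    by (simp add: h_def \<psi>_def)
qed

lemma state_prob_bounded:
  assumes "prob_space M"
  shows "0 \<le> state_prob M X k t" "\<bar>state_prob M X k t\<bar> \<le> 1"
  using prob_space.prob_le_1[OF assms] by (simp_all add: state_prob_def)

lemma state_prob_subordination:
  assumes \<nu>: "0 < \<nu>" "\<nu> \<le> 1" and r: "\<forall>k\<ge>1. r k > 0"
    and X: "fractional_birth_process M' \<nu> r X" and N: "classical_birth_process M r N"
    and T: "diffusion_random_time M \<nu> T" and t: "0 < t" and k: "1 \<le> k"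
  shows "state_prob M' X k t = (LINT s:{0..}|distr M borel (T t). state_prob M N k s)"
proof -
  interpret M: prob_space M
    using N unfolding fractional_birth_process_def by (elim conjE)
  have M': "prob_space M'"
    using X unfolding fractional_birth_process_def by (elim conjE)
  define p where "p = state_prob M' X"
  define q where "q = state_prob M N"
  have p: "solves_birth_system \<nu> r p" "\<And>k t. 0 \<le> t \<Longrightarrow> \<bar>p k t\<bar> \<le> 1"
    using X state_prob_bounded[OF M'] by (simp_all add: fractional_birth_process_def p_def)
  have q: "solves_birth_system 1 r q" "\<And>k t. 0 \<le> t \<Longrightarrow> \<bar>q k t\<bar> \<le> 1"
    using N state_prob_bounded[OF M.prob_space_axioms] by (simp_all add: fractional_birth_process_def q_def)
  obtain U where U: "fundamental_solution (2 * \<nu>) U"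
    and "\<forall>t>0. T t \<in> borel_measurable M \<and> (\<forall>\<omega>\<in>space M. T t \<omega> \<ge> 0) \<and>
      distr M borel (T t) = density (U t) (\<lambda>s. 2 * indicator {0<..} s)"
    using T unfolding diffusion_random_time_def by (elim exE conjE)
  then have Tt: "T t \<in> borel_measurable M" "distr M borel (T t) = density (U t) (\<lambda>s. 2 * indicator {0<..} s)"
    using t by simp_all
  interpret Ut: real_distribution "U t"
    using fundamental_solution_real_distribution[OF U] t by simp
  have dens: "(\<lambda>s. 2 * indicator {0<..} s :: ennreal) = (\<lambda>s. ennreal (2 * indicator {0<..} s))"
    by (auto simp: indicator_def)
  have contq: "continuous_on UNIV (\<lambda>s. q k (max 0 s))"
    by (intro continuous_on_compose2[OF birth_system_continuous[OF q(1) k]] continuous_intros) auto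
  have [measurable]: "(\<lambda>s. q k (max 0 s)) \<in> borel_measurable borel"
    using contq by (rule borel_measurable_continuous_onI)
  have "prob_space (distr M borel (T t))"
    by (rule M.prob_space_distr[OF Tt(1)])
  then have "prob_space (density (U t) (\<lambda>s. ennreal (2 * indicator {0<..} s)))"
    unfolding Tt(2) dens .
  from prob_space.prob_space[OF this]
  have "(1::real) = (LINT s|density (U t) (\<lambda>s. ennreal (2 * indicator {0<..} s)). 1)"
    by simp
  also have "\<dots> = (LINT s|U t. 2 * indicator {0<..} s)"
    by (subst integral_density) auto
  \<comment> \<open>As the law of the random time has total mass \<open>1\<close>, \<open>U t\<close> puts mass \<open>1/2\<close> on the open half-line.\<close>
  finally have mass: "(LINT s|U t. 2 * indicator {0<..} s) = (1::real)"
    by simp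
  have bnd: "\<bar>q k (max 0 s) - q k 0\<bar> \<le> 2" for s
    using q(2)[of "max 0 s" k] q(2)[of 0 k] by (simp add: abs_le_iff)
  have int1: "integrable (U t) (\<lambda>s. 2 * (q k (max 0 s) - q k 0))"
    by (intro integrable_mult_right Ut.integrable_bounded[OF _ bnd]) simp
  have int2: "integrable (U t) (\<lambda>s. q k 0 * (2 * indicator {0<..} s))"
    by (intro integrable_mult_right Ut.integrable_bounded[of _ 1]) (auto simp: indicator_def)
  have "(LINT s:{0..}|distr M borel (T t). q k s) =
      (LINT s|density (U t) (\<lambda>s. ennreal (2 * indicator {0<..} s)). indicator {0..} s * q k (max 0 s))"
    unfolding Tt(2) dens set_lebesgue_integral_def
    by (intro Bochner_Integration.integral_cong) (auto simp: indicator_def max_def)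
  also have "\<dots> = (LINT s|U t. 2 * indicator {0<..} s * (indicator {0..} s * q k (max 0 s)))"
    by (subst integral_density) auto
  also have "\<dots> = (LINT s|U t. 2 * (q k (max 0 s) - q k 0) + q k 0 * (2 * indicator {0<..} s))"
    by (intro Bochner_Integration.integral_cong) (auto simp: indicator_def max_def)
  also have "\<dots> = 2 * (LINT s|U t. q k (max 0 s) - q k 0) + q k 0"
    by (simp only: Bochner_Integration.integral_add[OF int1 int2] integral_mult_right_zero
      mass[unfolded integral_mult_right_zero] mult_1_right)
  also have "\<dots> = p k t"
    using birth_system_subordination[OF \<nu> r U k _ p q, of t] t by simp
  finally show ?thesis
    by (simp add: p_def q_def)
qed

section \<open>Evaluation at an independent random time\<close>

lemma open_singleton_enat: "open {enat k}"
proof -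
  have "{enat k} = {..<enat (Suc k)} \<inter> (if k = 0 then UNIV else {enat (k - 1)<..})"
  proof (rule set_eqI)
    fix x show "x \<in> {enat k} \<longleftrightarrow> x \<in> {..<enat (Suc k)} \<inter> (if k = 0 then UNIV else {enat (k - 1)<..})"
      by (cases x) auto
  qed
  moreover have "open ({..<enat (Suc k)} \<inter> (if k = 0 then UNIV else {enat (k - 1)<..}))"
    by (intro open_Int) auto
  ultimately show ?thesis by simp
qed

lemma tendsto_enat_eventually_eq_iff:
  assumes "(f \<longlongrightarrow> x) F"
  shows "\<forall>\<^sub>F i in F. f i = enat k \<longleftrightarrow> x = enat k"
proof (cases "x = enat k")
  case True
  then show ?thesis
    using topological_tendstoD[OF assms open_singleton_enat[of k]] by simp
next
  case False
  have "\<forall>\<^sub>F i in F. f i \<in> - {enat k}"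
    using False by (intro topological_tendstoD[OF assms]) auto
  then show ?thesis
    by eventually_elim (use False in auto)
qed

text \<open>Adding \<open>1\<close> puts the grid time strictly to the right of \<open>x\<close>, as right-continuity requires.\<close>

definition grid_index :: "nat \<Rightarrow> real \<Rightarrow> nat" where
  "grid_index n x = nat \<lfloor>real (Suc n) * x\<rfloor> + 1"

definition grid_time :: "nat \<Rightarrow> real \<Rightarrow> real" where
  "grid_time n x = real (grid_index n x) / real (Suc n)"

lemma grid_time_bounds:
  assumes "0 \<le> x"
  shows "x < grid_time n x" "grid_time n x \<le> x + 1 / real (Suc n)"
proof -
  have "0 \<le> real (Suc n) * x"
    using assms by simp
  then have "real (grid_index n x) = of_int \<lfloor>real (Suc n) * x\<rfloor> + 1"
    by (simp add: grid_index_def)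
  then have "real (Suc n) * x < real (grid_index n x)" "real (grid_index n x) \<le> real (Suc n) * x + 1"
    by linarith+
  then show "x < grid_time n x" "grid_time n x \<le> x + 1 / real (Suc n)"
    unfolding grid_time_def by (simp_all add: field_simps del: of_nat_Suc)
qed

lemma grid_time_tendsto:
  assumes "0 \<le> x"
  shows "(\<lambda>n. grid_time n x) \<longlonglongrightarrow> x"
proof (rule tendsto_sandwich)
  show "(\<lambda>n. x) \<longlonglongrightarrow> x" by simp
  show "(\<lambda>n. x + 1 / real (Suc n)) \<longlonglongrightarrow> x"
    using LIMSEQ_inverse_real_of_nat_add[of x] by (simp add: divide_inverse)
  show "\<forall>\<^sub>F n in sequentially. x \<le> grid_time n x"
    using grid_time_bounds(1)[OF assms] by (intro always_eventually) (auto intro: less_imp_le)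
  show "\<forall>\<^sub>F n in sequentially. grid_time n x \<le> x + 1 / real (Suc n)"
    using grid_time_bounds(2)[OF assms] by (intro always_eventually) auto
qed

lemma grid_index_measurable [measurable]: "grid_index n \<in> measurable borel (count_space UNIV)"
  unfolding grid_index_def[abs_def] by measurable

lemma grid_time_measurable [measurable]: "grid_time n \<in> borel_measurable borel"
  unfolding grid_time_def[abs_def] by measurable

lemma indep_of_process_prob:
  assumes M: "prob_space M" and indep: "indep_of_process M \<tau> N" and B: "B \<in> sets borel" and s: "0 \<le> s"
  shows "measure M ({\<omega> \<in> space M. \<tau> \<omega> \<in> B} \<inter> {\<omega> \<in> space M. N s \<omega> = a}) =
    measure M {\<omega> \<in> space M. \<tau> \<omega> \<in> B} * measure M {\<omega> \<in> space M. N s \<omega> = a}"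
proof -
  let ?P = "PiM {0..} (\<lambda>_::real. count_space (UNIV :: enat set))"
  have "{f \<in> space ?P. f s \<in> {a}} \<in> sets ?P"
    by (rule measurable_sets_Collect[OF measurable_component_singleton]) (use s in auto)
  from in_vimage_algebra[OF this, of "\<lambda>\<omega>. \<lambda>s\<in>{0..}. N s \<omega>" "space M"]
  have 1: "{\<omega> \<in> space M. N s \<omega> = a} \<in> sets (vimage_algebra (space M) (\<lambda>\<omega>. \<lambda>s\<in>{0..}. N s \<omega>) ?P)"
    using s by (simp add: space_PiM vimage_def Collect_conj_eq[symmetric] Int_def conj_commute)
  have "{\<omega> \<in> space M. \<tau> \<omega> \<in> B} = \<tau> -` B \<inter> space M"
    by auto
  then have 2: "{\<omega> \<in> space M. \<tau> \<omega> \<in> B} \<in> sets (vimage_algebra (space M) \<tau> borel)"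
    using in_vimage_algebra[OF B] by simp
  show ?thesis
    by (rule prob_space.indep_setD[OF M indep[unfolded indep_of_process_def] 2 1])
qed

text \<open>
  At a time with countably many values, independence reduces the claim to a sum over these values.
\<close>

lemma prob_at_grid_time:
  assumes M: "prob_space M" and N: "\<And>s. 0 \<le> s \<Longrightarrow> N s \<in> measurable M (count_space UNIV)"
    and \<tau> [measurable]: "\<tau> \<in> borel_measurable M" and indep: "indep_of_process M \<tau> N"
    and q [measurable]: "(\<lambda>s. q (max 0 s)) \<in> borel_measurable borel"
    and q_eq: "\<And>s. 0 \<le> s \<Longrightarrow> q s = measure M {\<omega> \<in> space M. N s \<omega> = a}"
  shows "{\<omega> \<in> space M. N (grid_time n (\<tau> \<omega>)) \<omega> = a} \<in> sets M"
    and "measure M {\<omega> \<in> space M. N (grid_time n (\<tau> \<omega>)) \<omega> = a} = (LINT \<omega>|M. q (grid_time n (\<tau> \<omega>)))"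
proof -
  interpret prob_space M by (rule M)
  define u where "u j = real j / real (Suc n)" for j
  have u: "0 \<le> u j" for j by (simp add: u_def)
  define A where "A j = {\<omega> \<in> space M. \<tau> \<omega> \<in> {x. grid_index n x = j}}" for j
  define B where "B j = {\<omega> \<in> space M. N (u j) \<omega> = a}" for j
  have S: "{x. grid_index n x = j} \<in> sets borel" for j
    by measurable
  have A: "A j \<in> sets M" for j
    unfolding A_def by measurable
  have B: "B j \<in> sets M" for j
    unfolding B_def using measurable_sets[OF N[OF u[of j]], of "{a}"]
    by (simp add: vimage_def Int_def conj_commute)
  have disj: "disjoint_family A"
    by (auto simp: disjoint_family_on_def A_def)
  then have disj2: "disjoint_family (\<lambda>j. A j \<inter> B j)"
    by (auto simp: disjoint_family_on_def)
  let ?E = "{\<omega> \<in> space M. N (grid_time n (\<tau> \<omega>)) \<omega> = a}"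
  have E: "?E = (\<Union>j. A j \<inter> B j)"
    by (auto simp: A_def B_def grid_time_def u_def)
  then show "?E \<in> sets M"
    using A B by auto
  have q0: "0 \<le> q (u j)" for j
    using q_eq[OF u] by simp
  have max_eq: "q (max 0 (grid_time n (\<tau> \<omega>))) = q (grid_time n (\<tau> \<omega>))" for \<omega>
    by (simp add: grid_time_def max_def)
  have qm: "(\<lambda>\<omega>. q (grid_time n (\<tau> \<omega>))) \<in> borel_measurable M"
    unfolding max_eq[symmetric] by measurable
  have q01: "0 \<le> q (grid_time n (\<tau> \<omega>)) \<and> q (grid_time n (\<tau> \<omega>)) \<le> 1" for \<omega>
    using q_eq[of "grid_time n (\<tau> \<omega>)"] by (simp add: grid_time_def)
  have "ennreal (measure M ?E) = (\<Sum>j. emeasure M (A j \<inter> B j))"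
    unfolding E emeasure_eq_measure[symmetric]
    using A B by (intro suminf_emeasure[OF _ disj2, symmetric]) auto
  also have "\<dots> = (\<Sum>j. ennreal (q (u j)) * emeasure M (A j))"
  proof (intro suminf_cong)
    fix j
    have "measure M (A j \<inter> B j) = measure M (A j) * q (u j)"
      unfolding A_def B_def q_eq[OF u] by (rule indep_of_process_prob[OF M indep S u])
    then show "emeasure M (A j \<inter> B j) = ennreal (q (u j)) * emeasure M (A j)"
      using q0 by (simp add: emeasure_eq_measure ennreal_mult mult.commute)
  qed
  also have "\<dots> = (\<Sum>j. \<integral>\<^sup>+\<omega>. ennreal (q (u j)) * indicator (A j) \<omega> \<partial>M)"
    using A by (simp add: nn_integral_cmult_indicator)
  also have "\<dots> = (\<integral>\<^sup>+\<omega>. (\<Sum>j. ennreal (q (u j)) * indicator (A j) \<omega>) \<partial>M)"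
    using A by (intro nn_integral_suminf[symmetric]) auto
  also have "\<dots> = (\<integral>\<^sup>+\<omega>. ennreal (q (grid_time n (\<tau> \<omega>))) \<partial>M)"
  proof (rule nn_integral_cong)
    fix \<omega> assume "\<omega> \<in> space M"
    then have "\<omega> \<in> A (grid_index n (\<tau> \<omega>))"
      by (simp add: A_def)
    from suminf_cmult_indicator[OF disj this, of "\<lambda>j. ennreal (q (u j))"]
    show "(\<Sum>j. ennreal (q (u j)) * indicator (A j) \<omega>) = ennreal (q (grid_time n (\<tau> \<omega>)))"
      by (simp add: u_def grid_time_def)
  qed
  also have "\<dots> = ennreal (LINT \<omega>|M. q (grid_time n (\<tau> \<omega>)))"
    using q01 by (intro nn_integral_eq_integral integrable_const_bound[where B = 1] qm) auto
  finally show "measure M ?E = (LINT \<omega>|M. q (grid_time n (\<tau> \<omega>)))"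
    using q01 by (subst (asm) ennreal_inj) auto
qed

text \<open>
  Along grid times converging to \<open>\<tau>\<close> from the right, right-continuity makes the events \<open>N = k\<close> converge pointwise,
  finite states being isolated in the topology of \<^typ>\<open>enat\<close>, and continuity of \<open>q\<close> gives the
  convergence of the means.
\<close>

lemma prob_at_random_time:
  assumes M: "prob_space M" and N: "\<And>s. 0 \<le> s \<Longrightarrow> N s \<in> measurable M (count_space UNIV)"
    and rc: "right_continuous_paths M N"
    and \<tau> [measurable]: "\<tau> \<in> borel_measurable M" and \<tau>0: "\<And>\<omega>. \<omega> \<in> space M \<Longrightarrow> 0 \<le> \<tau> \<omega>"
    and indep: "indep_of_process M \<tau> N"
    and q: "continuous_on {0..} q" and q_eq: "\<And>s. 0 \<le> s \<Longrightarrow> q s = measure M {\<omega> \<in> space M. N s \<omega> = enat k}"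
  shows "{\<omega> \<in> space M. N (\<tau> \<omega>) \<omega> = enat k} \<in> sets M"
    and "measure M {\<omega> \<in> space M. N (\<tau> \<omega>) \<omega> = enat k} = (LINT \<omega>|M. q (\<tau> \<omega>))"
proof -
  interpret prob_space M by (rule M)
  have "continuous_on UNIV (\<lambda>s. q (max 0 s))"
    by (intro continuous_on_compose2[OF q] continuous_intros) auto
  then have qm [measurable]: "(\<lambda>s. q (max 0 s)) \<in> borel_measurable borel"
    by (rule borel_measurable_continuous_onI)
  define E where "E n = {\<omega> \<in> space M. N (grid_time n (\<tau> \<omega>)) \<omega> = enat k}" for n
  define F where "F = {\<omega> \<in> space M. N (\<tau> \<omega>) \<omega> = enat k}"
  note grid = prob_at_grid_time[OF M N \<tau> indep qm q_eq, folded E_def]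
  have lim: "(\<lambda>n. indicator (E n) \<omega> :: real) \<longlonglongrightarrow> indicator F \<omega>" if \<omega>: "\<omega> \<in> space M" for \<omega>
  proof -
    have "filterlim (\<lambda>n. grid_time n (\<tau> \<omega>)) (at_right (\<tau> \<omega>)) sequentially"
      unfolding filterlim_at using grid_time_tendsto[OF \<tau>0[OF \<omega>]] grid_time_bounds(1)[OF \<tau>0[OF \<omega>]]
      by (auto intro!: always_eventually simp: less_imp_neq[symmetric])
    moreover have "((\<lambda>s. N s \<omega>) \<longlongrightarrow> N (\<tau> \<omega>) \<omega>) (at_right (\<tau> \<omega>))"
      using rc \<omega> \<tau>0[OF \<omega>] unfolding right_continuous_paths_def by simp
    ultimately have "(\<lambda>n. N (grid_time n (\<tau> \<omega>)) \<omega>) \<longlonglongrightarrow> N (\<tau> \<omega>) \<omega>"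
      by (rule filterlim_compose[rotated])
    from tendsto_enat_eventually_eq_iff[OF this, of k]
    have "\<forall>\<^sub>F n in sequentially. (indicator (E n) \<omega> :: real) = indicator F \<omega>"
      by eventually_elim (use \<omega> in \<open>auto simp: E_def F_def indicator_def\<close>)
    then show ?thesis
      by (rule tendsto_eventually)
  qed
  have "(indicator F :: _ \<Rightarrow> real) \<in> borel_measurable M"
    by (rule borel_measurable_LIMSEQ_real[OF lim]) (use grid(1) in auto)
  then have F: "F \<in> sets M"
    by (simp add: borel_measurable_indicator_iff F_def Int_def conj_commute)
  then show "{\<omega> \<in> space M. N (\<tau> \<omega>) \<omega> = enat k} \<in> sets M"
    by (simp add: F_def)
  have "(\<lambda>n. LINT \<omega>|M. indicator (E n) \<omega>) \<longlonglongrightarrow> (LINT \<omega>|M. (indicator F \<omega> :: real))"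
    by (rule integral_dominated_convergence[where w = "\<lambda>_. 1"])
      (use F grid(1) lim in \<open>auto simp: indicator_def\<close>)
  then have 1: "(\<lambda>n. LINT \<omega>|M. q (grid_time n (\<tau> \<omega>))) \<longlonglongrightarrow> measure M F"
    using F grid by simp
  have "(\<lambda>n. LINT \<omega>|M. q (max 0 (grid_time n (\<tau> \<omega>)))) \<longlonglongrightarrow> (LINT \<omega>|M. q (max 0 (\<tau> \<omega>)))"
  proof (rule integral_dominated_convergence[where w = "\<lambda>_. 1"])
    show "AE \<omega> in M. (\<lambda>n. q (max 0 (grid_time n (\<tau> \<omega>)))) \<longlonglongrightarrow> q (max 0 (\<tau> \<omega>))"
      using grid_time_tendsto[OF \<tau>0]
      by (intro AE_I2 continuous_on_tendsto_compose[OF q] tendsto_max tendsto_const) auto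
    show "AE \<omega> in M. norm (q (max 0 (grid_time n (\<tau> \<omega>)))) \<le> 1" for n
      using q_eq by simp
  qed auto
  moreover have "q (max 0 (grid_time n (\<tau> \<omega>))) = q (grid_time n (\<tau> \<omega>))" for n \<omega>
    by (simp add: grid_time_def max_def)
  moreover have "(LINT \<omega>|M. q (max 0 (\<tau> \<omega>))) = (LINT \<omega>|M. q (\<tau> \<omega>))"
    by (intro Bochner_Integration.integral_cong) (auto simp: \<tau>0 max_def)
  ultimately have "measure M F = (LINT \<omega>|M. q (\<tau> \<omega>))"
    using LIMSEQ_unique[OF 1] by simp
  then show "measure M {\<omega> \<in> space M. N (\<tau> \<omega>) \<omega> = enat k} = (LINT \<omega>|M. q (\<tau> \<omega>))"
    by (simp add: F_def)
qed

lemma measurable_enatI: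
  assumes "\<And>k. {\<omega> \<in> space M. f \<omega> = enat k} \<in> sets M"
  shows "f \<in> measurable M (count_space (UNIV :: enat set))"
proof -
  have "countable (UNIV :: enat set)"
    by (rule countableI_type)
  moreover have "f -` {a} \<inter> space M \<in> sets M" for a
  proof (cases a)
    case (enat k)
    then show ?thesis
      using assms[of k] by (simp add: vimage_def Int_def conj_commute)
  next
    case infinity
    have "f -` {\<infinity>} \<inter> space M = space M - (\<Union>k. {\<omega> \<in> space M. f \<omega> = enat k})"
      by auto
    then show ?thesis
      using assms infinity by auto
  qed
  ultimately show ?thesis
    by (simp add: measurable_count_space_eq_countable)
qed

text \<open>The mass of the exploded state is the complement of the masses of the finite states.\<close>

lemma prob_measure_eqI_enat:
  assumes P: "prob_space P" "sets P = UNIV" and Q: "prob_space Q" "sets Q = UNIV"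
    and eq: "\<And>k. measure P {enat k} = measure Q {enat k}"
  shows "P = Q"
proof (rule measure_eqI_countable[where A = UNIV])
  show "countable (UNIV :: enat set)"
    by (rule countableI_type)
  have "measure P {\<infinity>} = measure Q {\<infinity>}"
  proof -
    have "measure R {\<infinity>} = 1 - (\<Sum>k. measure R {enat k})" if R: "prob_space R" "sets R = UNIV" for R
    proof -
      interpret prob_space R by fact
      have "space R = UNIV"
        using R(2) sets.top[of R] sets.space_closed[of R] by auto
      have "(\<lambda>k. prob {enat k}) sums prob (\<Union>k. {enat k})"
        by (intro finite_measure_UNION) (auto simp: R disjoint_family_on_def)
      moreover have "prob (space R - (\<Union>k. {enat k})) = 1 - prob (\<Union>k. {enat k})"
        by (intro prob_compl) (simp add: R)
      moreover have "space R - (\<Union>k. {enat k}) = {\<infinity>}"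
        unfolding \<open>space R = UNIV\<close> by (auto simp: not_infinity_eq)
      ultimately show ?thesis
        by (simp add: sums_iff)
    qed
    from this[OF P] this[OF Q] show ?thesis
      by (simp add: eq)
  qed
  then have "measure P {a} = measure Q {a}" for a
    using eq by (cases a) auto
  then show "emeasure P {a} = emeasure Q {a}" for a
    using P(1) Q(1) by (simp add: prob_space_def finite_measure.emeasure_eq_measure)
qed (simp_all add: P Q)

theorem mainTheorem2:
  fixes \<nu> :: real and r :: "nat \<Rightarrow> real"
    and M' :: "'b measure" and N\<^sub>\<nu> :: "real \<Rightarrow> 'b \<Rightarrow> enat"
    and M :: "'a measure" and N :: "real \<Rightarrow> 'a \<Rightarrow> enat" and T :: "real \<Rightarrow> 'a \<Rightarrow> real"
  assumes "0 < \<nu>" and "\<nu> \<le> 1"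
    and "\<forall>k\<ge>1. r k > 0" and "inj_on r {1..}"
    and "fractional_birth_process M' \<nu> r N\<^sub>\<nu>"
    and "classical_birth_process M r N"
    and "diffusion_random_time M \<nu> T"
    and "\<forall>t>0. indep_of_process M (T t) N"
  shows "(\<forall>t>0. \<forall>k\<ge>1. measure M' {\<omega> \<in> space M'. N\<^sub>\<nu> t \<omega> = enat k} =
            (LINT s:{0..}|distr M borel (T t). measure M {\<omega> \<in> space M. N s \<omega> = enat k})) \<and>
         (right_continuous_paths M N \<longrightarrow>
            (\<forall>t>0. distr M' (count_space UNIV) (N\<^sub>\<nu> t) =
                   distr M (count_space UNIV) (\<lambda>\<omega>. N (T t \<omega>) \<omega>)))"
proof (intro conjI impI allI)
  note subord = state_prob_subordination[OF assms(1,2,3,5,6,7), unfolded state_prob_def]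
  fix t :: real and k :: nat assume "0 < t" "1 \<le> k"
  then show "measure M' {\<omega> \<in> space M'. N\<^sub>\<nu> t \<omega> = enat k} =
      (LINT s:{0..}|distr M borel (T t). measure M {\<omega> \<in> space M. N s \<omega> = enat k})"
    by (rule subord)
next
  note subord = state_prob_subordination[OF assms(1,2,3,5,6,7), unfolded state_prob_def]
  assume rc: "right_continuous_paths M N"
  fix t :: real assume t: "0 < t"
  have N: "prob_space M" "\<And>s. 0 \<le> s \<Longrightarrow> N s \<in> measurable M (count_space UNIV)"
    "\<And>s \<omega>. 0 \<le> s \<Longrightarrow> \<omega> \<in> space M \<Longrightarrow> 1 \<le> N s \<omega>" "solves_birth_system 1 r (state_prob M N)"
    using assms(6) by (simp_all add: fractional_birth_process_def)
  have N': "prob_space M'" "N\<^sub>\<nu> t \<in> measurable M' (count_space UNIV)"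
    "\<And>\<omega>. \<omega> \<in> space M' \<Longrightarrow> 1 \<le> N\<^sub>\<nu> t \<omega>"
    using assms(5) t by (simp_all add: fractional_birth_process_def)
  have T: "T t \<in> borel_measurable M" "\<And>\<omega>. \<omega> \<in> space M \<Longrightarrow> 0 \<le> T t \<omega>"
    using assms(7) t by (auto simp: diffusion_random_time_def)
  have indep: "indep_of_process M (T t) N"
    using assms(8) t by simp
  define Y where "Y \<omega> = N (T t \<omega>) \<omega>" for \<omega>
  have zero: "{\<omega> \<in> space M. Y \<omega> = enat 0} = {}" "{\<omega> \<in> space M'. N\<^sub>\<nu> t \<omega> = enat 0} = {}"
    using N(3)[OF T(2)] N'(3) by (force simp: Y_def enat_0)+
  have Y: "{\<omega> \<in> space M. Y \<omega> = enat k} \<in> sets M"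
    "measure M {\<omega> \<in> space M. Y \<omega> = enat k} = measure M' {\<omega> \<in> space M'. N\<^sub>\<nu> t \<omega> = enat k}" if "1 \<le> k" for k
  proof -
    define q where "q = state_prob M N k"
    have q: "continuous_on {0..} q"
      unfolding q_def by (rule birth_system_continuous[OF N(4) that])
    have q_eq: "q s = measure M {\<omega> \<in> space M. N s \<omega> = enat k}" for s
      by (simp add: q_def state_prob_def)
    note Y = prob_at_random_time[OF N(1,2) rc T indep q q_eq, folded Y_def]
    show "{\<omega> \<in> space M. Y \<omega> = enat k} \<in> sets M"
      by (rule Y(1))
    have "continuous_on UNIV (\<lambda>s. q (max 0 s))"
      by (intro continuous_on_compose2[OF q] continuous_intros) auto
    then have [measurable]: "(\<lambda>s. q (max 0 s)) \<in> borel_measurable borel"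
      by (rule borel_measurable_continuous_onI)
    have "measure M' {\<omega> \<in> space M'. N\<^sub>\<nu> t \<omega> = enat k} = (LINT s:{0..}|distr M borel (T t). q s)"
      using subord[OF t that] by (simp add: q_eq)
    also have "\<dots> = (LINT s|distr M borel (T t). indicator {0..} s * q (max 0 s))"
      unfolding set_lebesgue_integral_def
      by (intro Bochner_Integration.integral_cong) (auto simp: indicator_def max_def)
    also have "\<dots> = (LINT \<omega>|M. indicator {0..} (T t \<omega>) * q (max 0 (T t \<omega>)))"
      by (rule integral_distr[OF T(1)]) measurable
    also have "\<dots> = (LINT \<omega>|M. q (T t \<omega>))"
      by (intro Bochner_Integration.integral_cong) (auto simp: T(2) max_def)
    finally show "measure M {\<omega> \<in> space M. Y \<omega> = enat k} = measure M' {\<omega> \<in> space M'. N\<^sub>\<nu> t \<omega> = enat k}"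
      using Y(2) by simp
  qed
  have Y_meas: "Y \<in> measurable M (count_space UNIV)"
  proof (rule measurable_enatI)
    show "{\<omega> \<in> space M. Y \<omega> = enat k} \<in> sets M" for k
    proof (cases k)
      case 0
      show ?thesis
        unfolding 0 zero by simp
    qed (simp add: Y(1))
  qed
  have "distr M' (count_space UNIV) (N\<^sub>\<nu> t) = distr M (count_space UNIV) Y"
  proof (rule prob_measure_eqI_enat)
    show "prob_space (distr M' (count_space UNIV) (N\<^sub>\<nu> t))" "prob_space (distr M (count_space UNIV) Y)"
      using N(1) N' Y_meas by (auto intro: prob_space.prob_space_distr)
    fix k
    have eq: "N\<^sub>\<nu> t -` {enat k} \<inter> space M' = {\<omega> \<in> space M'. N\<^sub>\<nu> t \<omega> = enat k}"
      "Y -` {enat k} \<inter> space M = {\<omega> \<in> space M. Y \<omega> = enat k}"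
      by auto
    have "measure M' {\<omega> \<in> space M'. N\<^sub>\<nu> t \<omega> = enat k} = measure M {\<omega> \<in> space M. Y \<omega> = enat k}"
    proof (cases k)
      case 0
      show ?thesis
        unfolding 0 zero by simp
    qed (simp add: Y(2))
    then show "measure (distr M' (count_space UNIV) (N\<^sub>\<nu> t)) {enat k} = measure (distr M (count_space UNIV) Y) {enat k}"
      using N'(2) Y_meas by (simp add: measure_distr eq)
  qed simp_all
  then show "distr M' (count_space UNIV) (N\<^sub>\<nu> t) = distr M (count_space UNIV) (\<lambda>\<omega>. N (T t \<omega>) \<omega>)"
    by (simp add: Y_def[abs_def])
qed

end
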